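(* Let $q\ge5$ be an integer. For $n\ge0$, $x_L,x_0,x_R\in[q]$ and $\mathbf x=(x_1,\dots,x_n)\in[q]^n$, define $P(x_L,x_0,x_R;\mathbf x)$ as follows. - $P(x_L,x_0,x_R;\emptyset)=P^*(x_Lx_0x_R)$. - If the coloring $(x_L,x_0,x_R;\mathbf x)$ is not a proper coloring of $\mathscr S^3_{(1,1,n)}$, then $P(x_L,x_0,x_R;\mathbf x)=0$. - If $n\ge1$, the coloring is proper and $x_L\ne x_R$, then $$P(x_L,x_0,x_R;\mathbf x)=\frac{1}{C(n+2)D(n+1)}\left(\sum_{i=1}^nC(2i+1)\,P(x_L,x_0,x_R;\widehat{\mathbf x}_i)+C(1)\,P(x_L,x_1,x_R;\widehat{\mathbf x}_1)\right).$$ - If $n\ge1$, the coloring is proper and $x_L=x_R$, then $$P(x_L,x_0,x_R;\mathbf x)=P^*(x_Lx_0\mathbf x)-\sum_{x_R'\in[q]\setminus\{x_0,x_R\}}P(x_L,x_0,x_R';\mathbf x).$$ Then $P$ defines a $1$-dependent $q$-coloring of $\mathscr S^3_{(1,1,\infty)}$, i.e. there is a $1$-dependent $q$-coloring $X$ of $\mathscr S^3_{(1,1,\infty)}$ with $\mathbb P(X_{v_{11}}=x_L,\,X_{v_0}=x_0,\,X_{v_{21}}=x_R,\,X_{v_{3j}}=x_j\ (1\le j\le n))=P(x_L,x_0,x_R;\mathbf x)$ for all $n$, $x_L,x_0,x_R,\mathbf x$; and it satisfies: (i) $X$ is invariant in law under permutations of the colors; (ii) the restriction of $X$ to any path is distributed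 according to $P^*$, i.e. for every path of distinct, consecutively adjacent vertices $u_1,\dots,u_k$ and every $\mathbf y\in[q]^k$, $\mathbb P(X_{u_1}=y_1,\dots,X_{u_k}=y_k)=P^*(\mathbf y)$.
   Context: $[q]=\{1,\dots,q\}$. $\mathscr S^3_{(1,1,\infty)}$ is the graph with a distinguished vertex $v_0$, two leaves $v_{11}$ and $v_{21}$ adjacent to $v_0$, and an infinite ray $(v_{31},v_{32},\dots)$ with $v_{31}$ adjacent to $v_0$ and $v_{3j}$ adjacent to $v_{3,j+1}$. $\mathscr S^3_{(1,1,n)}$ is the subgraph keeping only $v_{31},\dots,v_{3n}$ of the long ray. In $(x_L,x_0,x_R;\mathbf x)$, $x_0$ is the color of $v_0$, $x_L$ and $x_R$ are the colors of the leaves $v_{11},v_{21}$, and $x_j$ is the color of $v_{3j}$; it is proper if adjacent vertices have different colors. $\widehat{\mathbf x}_i$ is obtained from $\mathbf x$ by deleting its $i$th entry; $x_Lx_0\mathbf x$ denotes concatenation. For a simple graph $G=(V,E)$, a process $X=(X_v)_{v\in V}$ is a (proper) $q$-coloring if each $X_v\in[q]$ and almost surely $X_u\neq X_v$ whenever $u,v$ are neighbors; it is $1$-dependent if its restrictions to two subsets of $V$ are independent whenever these subsets are at graph distance larger than $1$. It is invariant in law under permutations of the colors if $(\sigma(X_v))_{v\in V}$ has the same law as $X$ for every permutation $\sigma$ of $[q]$. The coefficients: $C(n)=T_n(\sqrt q/2)$ for $n\ge0$, extended by $C(-n)=C(n)$, and $D(n)=\sqrt q\,U_{n-1}(\sqrt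 q/2)$ for $n\ge1$, where $T_n,U_n$ are the Chebyshev polynomials of the first and second kind. The function $P^*$: $P^*(\emptyset)=1$, $P^*(\mathbf x)=0$ if $\mathbf x\in[q]^n$ is not proper (i.e. $x_i=x_{i+1}$ for some $i$), and for proper $\mathbf x\in[q]^n$, $n\ge1$, $$P^*(\mathbf x)=\frac1{D(n+1)}\sum_{j=1}^nC(n-2j+1)\,P^*(\widehat{\mathbf x}_j).$$ For $q\ge4$ these are the cylinder probabilities of a stationary $1$-dependent $q$-coloring of $\mathbb Z$. *)

theory Defs
  imports "HOL-Probability.Probability" "HOL-Library.Extended_Nat"
    "HOL-Computational_Algebra.Polynomial" "HOL-Combinatorics.Permutations"
begin

section \<open>Coefficients\<close>

fun chebyshev_T :: "nat \<Rightarrow> real poly" where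
  "chebyshev_T 0 = 1"
| "chebyshev_T (Suc 0) = [:0, 1:]"
| "chebyshev_T (Suc (Suc n)) = [:0, 2:] * chebyshev_T (Suc n) - chebyshev_T n"

fun chebyshev_U :: "nat \<Rightarrow> real poly" where
  "chebyshev_U 0 = 1"
| "chebyshev_U (Suc 0) = [:0, 2:]"
| "chebyshev_U (Suc (Suc n)) = [:0, 2:] * chebyshev_U (Suc n) - chebyshev_U n"

definition coeff_C :: "nat \<Rightarrow> int \<Rightarrow> real" where
  "coeff_C q k = poly (chebyshev_T (nat \<bar>k\<bar>)) (sqrt (real q) / 2)"

text \<open>Only meaningful for \<^prop>\<open>n \<ge> 1\<close>, because of the truncated subtraction.\<close>
definition coeff_D :: "nat \<Rightarrow> nat \<Rightarrow> real" where
  "coeff_D q n = sqrt (real q) * poly (chebyshev_U (n - 1)) (sqrt (real q) / 2)"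

section \<open>Graphs and colorings\<close>

text \<open>A simple graph is given by a vertex set \<open>V\<close> and a symmetric, irreflexive edge
  relation \<open>E \<subseteq> V \<times> V\<close>.  A pair is in \<open>E ^^ n\<close> iff it is joined by a walk of length \<open>n\<close>;
  the infimum of the empty set is \<open>\<infinity>\<close>.\<close>

definition graph_dist :: "('v \<times> 'v) set \<Rightarrow> 'v \<Rightarrow> 'v \<Rightarrow> enat" where
  "graph_dist E u v = (INF n\<in>{n. (u, v) \<in> E ^^ n}. enat n)"

definition set_graph_dist :: "('v \<times> 'v) set \<Rightarrow> 'v set \<Rightarrow> 'v set \<Rightarrow> enat" where
  "set_graph_dist E A B = (INF u\<in>A. INF v\<in>B. graph_dist E u v)"

definition proper_coloring :: "('v \<times> 'v) set \<Rightarrow> ('v \<Rightarrow> nat) \<Rightarrow> bool" where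
  "proper_coloring E c \<longleftrightarrow> (\<forall>(u, v)\<in>E. c u \<noteq> c v)"

definition graph_path :: "'v set \<Rightarrow> ('v \<times> 'v) set \<Rightarrow> 'v list \<Rightarrow> bool" where
  "graph_path V E us \<longleftrightarrow>
     set us \<subseteq> V \<and> distinct us \<and> successively (\<lambda>u v. (u, v) \<in> E) us"

text \<open>The joint law of \<open>(X v)\<close>, \<open>v \<in> A\<close>, lives on \<open>\<Pi>\<^sub>M v\<in>A. [q]\<close>.\<close>

abbreviation color_space :: "nat \<Rightarrow> 'v set \<Rightarrow> ('v \<Rightarrow> nat) measure" where
  "color_space q A \<equiv> (\<Pi>\<^sub>M v\<in>A. count_space {1..q})"

definition random_coloring ::
  "nat \<Rightarrow> 'v set \<Rightarrow> ('v \<times> 'v) set \<Rightarrow> 'a measure \<Rightarrow> ('v \<Rightarrow> 'a \<Rightarrow> nat) \<Rightarrow> bool" where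
  "random_coloring q V E M X \<longleftrightarrow>
     (\<forall>v\<in>V. X v \<in> M \<rightarrow>\<^sub>M count_space {1..q}) \<and>
     (\<forall>(u, v)\<in>E. AE \<omega> in M. X u \<omega> \<noteq> X v \<omega>)"

definition one_dependent ::
  "nat \<Rightarrow> 'v set \<Rightarrow> ('v \<times> 'v) set \<Rightarrow> 'a measure \<Rightarrow> ('v \<Rightarrow> 'a \<Rightarrow> nat) \<Rightarrow> bool" where
  "one_dependent q V E M X \<longleftrightarrow>
     (\<forall>A B. A \<subseteq> V \<longrightarrow> B \<subseteq> V \<longrightarrow> set_graph_dist E A B > 1 \<longrightarrow>
        prob_space.indep_var M
          (color_space q A) (\<lambda>\<omega>. \<lambda>v\<in>A. X v \<omega>)
          (color_space q B) (\<lambda>\<omega>. \<lambda>v\<in>B. X v \<omega>))"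

definition color_invariant ::
  "nat \<Rightarrow> 'v set \<Rightarrow> 'a measure \<Rightarrow> ('v \<Rightarrow> 'a \<Rightarrow> nat) \<Rightarrow> bool" where
  "color_invariant q V M X \<longleftrightarrow>
     (\<forall>\<sigma>. \<sigma> permutes {1..q} \<longrightarrow>
        distr M (color_space q V) (\<lambda>\<omega>. \<lambda>v\<in>V. \<sigma> (X v \<omega>)) =
        distr M (color_space q V) (\<lambda>\<omega>. \<lambda>v\<in>V. X v \<omega>))"

section \<open>The star graphs with arms of lengths 1, 1 and \<open>n\<close>\<close>

text \<open>\<open>Center\<close> is $v_0$ and \<open>Arm i j\<close> is $v_{ij}$; only the \<open>Arm i j\<close> listed in
  \<open>star_verts\<close> are vertices.\<close>

datatype vertex = Center | Arm nat nat

definition star_verts :: "enat \<Rightarrow> vertex set" where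
  "star_verts n = {Center, Arm 1 1, Arm 2 1} \<union> {Arm 3 j | j. 1 \<le> j \<and> enat j \<le> n}"

definition oriented_edges :: "(vertex \<times> vertex) set" where
  "oriented_edges = {(Center, Arm i 1) | i. i \<in> {1, 2, 3}} \<union> {(Arm 3 j, Arm 3 (j + 1)) | j. 1 \<le> j}"

definition star_edges :: "enat \<Rightarrow> (vertex \<times> vertex) set" where
  "star_edges n = (oriented_edges \<union> oriented_edges\<inverse>) \<inter> (star_verts n \<times> star_verts n)"

text \<open>The coloring $(x_L, x_0, x_R; x_1, \ldots, x_n)$; list positions start at 0.\<close>

fun star_coloring :: "nat \<Rightarrow> nat \<Rightarrow> nat \<Rightarrow> nat list \<Rightarrow> vertex \<Rightarrow> nat" where
  "star_coloring xL x0 xR xs Center = x0"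
| "star_coloring xL x0 xR xs (Arm i j) =
     (if i = 1 then xL else if i = 2 then xR else xs ! (j - 1))"

lemma proper_star_coloring_iff:
  "proper_coloring (star_edges (length xs)) (star_coloring xL x0 xR xs) \<longleftrightarrow>
     x0 \<noteq> xL \<and> x0 \<noteq> xR \<and> distinct_adj (x0 # xs)" (is "?l \<longleftrightarrow> ?r")
proof
  assume l: ?l
  have e: "star_coloring xL x0 xR xs u \<noteq> star_coloring xL x0 xR xs v"
    if "(u, v) \<in> star_edges (length xs)" for u v
    using l that by (auto simp: proper_coloring_def)
  have 1: "x0 \<noteq> xL" using e[of Center "Arm 1 1"]
    by (auto simp: star_edges_def oriented_edges_def star_verts_def)
  have 2: "x0 \<noteq> xR" using e[of Center "Arm 2 1"]
    by (auto simp: star_edges_def oriented_edges_def star_verts_def)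
  have "(x0 # xs) ! i \<noteq> (x0 # xs) ! Suc i" if "Suc i < length (x0 # xs)" for i
  proof (cases i)
    case 0
    then show ?thesis using that e[of Center "Arm 3 1"]
      by (cases xs) (auto simp: star_edges_def oriented_edges_def star_verts_def)
  next
    case (Suc k)
    then show ?thesis using that e[of "Arm 3 (Suc k)" "Arm 3 (Suc (Suc k))"]
      by (auto simp: star_edges_def oriented_edges_def star_verts_def)
  qed
  with 1 2 show ?r by (auto simp: distinct_adj_conv_nth)
next
  assume r: ?r
  have d: "(x0 # xs) ! i \<noteq> (x0 # xs) ! Suc i" if "i < length xs" for i
    using r that by (simp add: distinct_adj_conv_nth)
  have 3: "xs ! (j - Suc 0) \<noteq> xs ! j" if "1 \<le> j" "j < length xs" for j
    using d[of j] that by simp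
  have 4: "x0 \<noteq> xs ! 0" if "Suc 0 \<le> length xs" using d[of 0] that by (cases xs) auto
  show ?l using r 3 4
    by (fastforce simp: proper_coloring_def star_edges_def oriented_edges_def star_verts_def)
qed

section \<open>The functions \<open>P\<^sup>*\<close> and \<open>P\<close>\<close>

text \<open>Deletes the \<open>i\<close>-th entry, counting from 1.\<close>
definition del :: "nat \<Rightarrow> 'a list \<Rightarrow> 'a list" where
  "del i xs = take (i - 1) xs @ drop i xs"

lemma length_del: "i \<in> {1..length xs} \<Longrightarrow> length (del i xs) < length xs"
  by (auto simp: del_def)

function Pstar :: "nat \<Rightarrow> nat list \<Rightarrow> real" where
  "Pstar q xs =
     (if xs = [] then 1
      else if \<not> distinct_adj xs then 0
      else (\<Sum>j\<in>{1..length xs}. coeff_C q (int (length xs) - 2 * int j + 1) * Pstar q (del j xs))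
             / coeff_D q (length xs + 1))"
  by pat_completeness auto
termination
  by (relation "measures [\<lambda>(q, xs). length xs]") (use length_del in auto)

declare Pstar.simps [simp del]

text \<open>The clause for \<open>xL = xR\<close> refers to words of the same length, but only with distinct
  leaf colors.\<close>

function P_star_graph :: "nat \<Rightarrow> nat \<Rightarrow> nat \<Rightarrow> nat \<Rightarrow> nat list \<Rightarrow> real" where
  "P_star_graph q xL x0 xR xs =
     (if xs = [] then Pstar q [xL, x0, xR]
      else if \<not> proper_coloring (star_edges (length xs)) (star_coloring xL x0 xR xs) then 0
      else if xL \<noteq> xR then
        ((\<Sum>i\<in>{1..length xs}. coeff_C q (2 * int i + 1) * P_star_graph q xL x0 xR (del i xs))
           + coeff_C q 1 * P_star_graph q xL (xs ! 0) xR (del 1 xs))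
          / (coeff_C q (int (length xs) + 2) * coeff_D q (length xs + 1))
      else Pstar q (xL # x0 # xs) - (\<Sum>xR'\<in>{1..q} - {x0, xR}. P_star_graph q xL x0 xR' xs))"
  by pat_completeness auto
termination
  by (relation "measures [\<lambda>(q, xL, x0, xR, xs). length xs,
                          \<lambda>(q, xL, x0, xR, xs). if xL = xR then 1 else 0]")
     (auto simp: length_del Suc_le_eq)

declare P_star_graph.simps [simp del]

end

theory Submission
  imports Defs
begin

text \<open>The coloring exists because its prescribed finite-dimensional probabilities are nonnegative and
  because summing out the color of one vertex of the long arm, or of the center, cuts the probability
  into a product.  The latter property contains both consistency and \<open>1\<close>-dependence.

  Write \<open>sqrt q = 2 * cosh t\<close>.  The coefficients are then \<open>C(n) = cosh (n * t)\<close> and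
  \<open>D(n) = 2 * cosh t * sinh (n * t) / sinh t\<close>, and every identity between them is an addition theorem.
  For the line, the recursion with hyperbolic cosines has a companion with hyperbolic sines
  (\<open>Ps_sinh_sum\<close>), so that the weights of the recursion may be shifted arbitrarily
  (\<open>Ps_shifted_sum\<close>).  For the star, fix the two leaf colors and read the center and the long arm as
  one word.  The recursion then deletes each letter of this word, the center included, with the weights
  \<open>C(1), C(3), C(5), \<dots>\<close>.  A shift gives \<open>P\<^sup>*\<close> a recursion with the same weights, the only differences
  being the normalization and the forbidden colors of the first letter.  The lemma
  \<open>deletion_functional_factors\<close> treats both cases at once: it sums the recursion over the color of one
  letter, where the improper words that the recursion does not cover contribute exactly what the
  identity \<open>q * C(k) = C(k - 2) + 2 * C(k) + C(k + 2)\<close> removes.  Equal leaves follow from different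
  ones by linearity.

  Nonnegativity is evident except for equal leaves, where the probability is a difference.  It satisfies
  a recursion with the negative term \<open>- q * C(1) * P\<^sup>*\<close> (\<open>equal_leaves_rec\<close>).  Since the normalizing
  factors grow exponentially, this term costs little at each step, and for \<open>q \<ge> 5\<close> a positive fraction of
  \<open>P\<^sup>*\<close> survives as a lower bound at every length (\<open>equal_leaves_lower_bound\<close>).

  The random coloring is then built letter by letter from its conditional probabilities.  Its
  \<open>1\<close>-dependence for arbitrary separated vertex sets is obtained by cutting the tree repeatedly at single
  vertices (\<open>box_one_dependent\<close>), and a path of the star either runs along one of the two lines through
  the long arm or consists of the center and the two leaves (\<open>path_cases\<close>).\<close>

section \<open>Deleting an entry of a word\<close>

lemma del_Cons_0 [simp]: "del (Suc 0) (x # xs) = xs"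
  by (simp add: del_def)

lemma del_Cons_Suc [simp]: "del (Suc (Suc j)) (x # xs) = x # del (Suc j) xs"
  by (simp add: del_def)

lemma length_del_Suc [simp]: "j < length xs \<Longrightarrow> length (del (Suc j) xs) = length xs - 1"
  by (auto simp: del_def)

lemma set_del_subset: "set (del i xs) \<subseteq> set xs"
  by (auto simp: del_def dest: in_set_takeD in_set_dropD)

lemma map_del: "map f (del i xs) = del i (map f xs)"
  by (simp add: del_def take_map drop_map)

lemma del_append_left: "j < length u \<Longrightarrow> del (Suc j) (u @ v) = del (Suc j) u @ v"
  by (simp add: del_def)

lemma del_append_right: "del (Suc (length u + j)) (u @ v) = u @ del (Suc j) v"
  by (simp add: del_def)

lemma del_del:
  assumes "j \<le> k" "k < length xs - 1"
  shows "del (Suc k) (del (Suc j) xs) = del (Suc j) (del (Suc (Suc k)) xs)"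
  using assms
proof (induction xs arbitrary: j k)
  case (Cons x xs)
  show ?case
  proof (cases j)
    case 0
    then show ?thesis by simp
  next
    case (Suc j')
    then obtain k' where "k = Suc k'" using Cons.prems by (cases k) auto
    then show ?thesis using Suc Cons.IH[of j' k'] Cons.prems by auto
  qed
qed simp

lemma del_rev:
  assumes "j < length xs"
  shows "del (Suc j) (rev xs) = rev (del (length xs - j) xs)"
  using assms by (simp add: del_def rev_take rev_drop Suc_diff_Suc)

lemma sum_lessThan_add:
  fixes g :: "nat \<Rightarrow> 'a::comm_monoid_add"
  shows "(\<Sum>j<m + n. g j) = (\<Sum>j<m. g j) + (\<Sum>j<n. g (m + j))"
  by (induction n) (simp_all add: add.assoc)

lemma sum_del_append:
  fixes f :: "nat \<Rightarrow> 'b list \<Rightarrow> 'a::comm_monoid_add"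
  shows "(\<Sum>j<length (u @ v). f j (del (Suc j) (u @ v))) =
    (\<Sum>j<length u. f j (del (Suc j) u @ v)) + (\<Sum>j<length v. f (length u + j) (u @ del (Suc j) v))"
  by (simp add: sum_lessThan_add del_append_left del_append_right)

lemma sum_del_Cons:
  fixes f :: "nat \<Rightarrow> 'b list \<Rightarrow> 'a::comm_monoid_add"
  shows "(\<Sum>j<length (a # v). f j (del (Suc j) (a # v))) =
    f 0 v + (\<Sum>j<length v. f (Suc j) (a # del (Suc j) v))"
  using sum_del_append[of f "[a]" v] by simp

text \<open>Only the two deletions that remove one of the two equal neighbours can repair an
  improper word, and both give the same word.\<close>

lemma sum_del_repeat:
  fixes Q :: "nat list \<Rightarrow> real"
  assumes Q0: "\<And>w. \<not> distinct_adj w \<Longrightarrow> Q w = 0"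
  shows "(\<Sum>j<length (u @ a # a # v). f j * Q (del (Suc j) (u @ a # a # v))) =
    (f (length u) + f (Suc (length u))) * Q (u @ a # v)"
proof -
  have 1: "Q (del (Suc j) u @ a # a # v) = 0" for j
    by (rule Q0) (auto simp: distinct_adj_append_iff)
  have 2: "Q (u @ a # a # del (Suc j) v) = 0" for j
    by (rule Q0) (auto simp: distinct_adj_append_iff)
  show ?thesis
    unfolding sum_del_append[of "\<lambda>j w. f j * Q w" u] sum_del_Cons[of "\<lambda>j w. f (length u + j) * Q (u @ w)"]
      sum_del_Cons[of "\<lambda>j w. f (length u + Suc j) * Q (u @ a # w)"]
    by (simp add: 1 2 distrib_right)
qed

lemma improper_del_cases:
  assumes "distinct_adj xs" "j < length xs" "\<not> distinct_adj (del (Suc j) xs)"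
  obtains u b c v where "xs = u @ b # c # b # v" "j = Suc (length u)"
proof -
  have xs: "xs = take j xs @ xs ! j # drop (Suc j) xs"
    using assms(2) by (simp add: id_take_nth_drop)
  define u v where "u = take j xs" and "v = drop (Suc j) xs"
  have xs': "xs = u @ xs ! j # v" and d: "del (Suc j) xs = u @ v"
    using xs by (simp_all add: u_def v_def del_def)
  have "distinct_adj u" "distinct_adj v" using assms(1) unfolding u_def v_def
    by (metis append_take_drop_id distinct_adj_append_iff)+
  with assms(3) d have "u \<noteq> []" "v \<noteq> []" "last u = hd v"
    by (auto simp: distinct_adj_append_iff)
  then obtain u' v' b where "u = u' @ [b]" "v = b # v'"
    by (metis append_butlast_last_id list.collapse)
  moreover have "length u = j" using assms(2) by (simp add: u_def)
  ultimately show ?thesis using xs' by (intro that[of u' b "xs ! j" v']) auto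
qed

lemma sum_antisymmetric_zero:
  fixes g :: "'a \<Rightarrow> real"
  assumes "\<And>x. x \<in> S \<Longrightarrow> \<phi> x \<in> S" "\<And>x. x \<in> S \<Longrightarrow> \<phi> (\<phi> x) = x" "\<And>x. x \<in> S \<Longrightarrow> g (\<phi> x) = - g x"
  shows "sum g S = 0"
proof -
  have "sum g S = (\<Sum>x\<in>S. g (\<phi> x))"
    by (rule sum.reindex_bij_witness[of _ \<phi> \<phi>]) (use assms in auto)
  also have "\<dots> = - sum g S" using assms(3) by (simp add: sum_negf)
  finally show ?thesis by simp
qed

section \<open>The coefficients as hyperbolic functions\<close>

locale five_colors =
  fixes q :: nat
  assumes q5: "q \<ge> 5"
begin

text \<open>\<open>cc\<close> and \<open>dd\<close> are the coefficients \<open>C\<close> and \<open>D\<close>, extended to real arguments so that shifted indices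
  need no case distinctions; \<open>ss\<close> is the sine that accompanies \<open>cc\<close> in the addition theorems.\<close>

definition rate :: real where "rate = arcosh (sqrt (real q) / 2)"

definition cc :: "real \<Rightarrow> real" where "cc r = cosh (r * rate)"
definition ss :: "real \<Rightarrow> real" where "ss r = sinh (r * rate)"
definition dd :: "real \<Rightarrow> real" where "dd r = 2 * cc 1 * ss r / ss 1"

lemma sqrt_q_gt_2: "sqrt (real q) > 2"
  using q5 real_less_rsqrt[of 2 "real q"] by (simp add: power2_eq_square)

lemma rate_pos: "rate > 0"
  using sqrt_q_gt_2 by (simp add: rate_def)

lemma cc_1: "cc 1 = sqrt (real q) / 2"
  using sqrt_q_gt_2 by (simp add: cc_def rate_def)

lemma q_eq: "real q = 4 * (cc 1)\<^sup>2"
  by (simp add: cc_1 power_divide)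

lemma ss_1_pos: "ss 1 > 0"
  using rate_pos by (simp add: ss_def)

lemma cc_pos: "cc r > 0"
  by (simp add: cc_def)

lemma cc_ge_1: "cc r \<ge> 1"
  by (simp add: cc_def cosh_real_ge_1)

lemma ss_nonneg: "r \<ge> 0 \<Longrightarrow> ss r \<ge> 0"
  using rate_pos by (simp add: ss_def)

lemma ss_pos: "r > 0 \<Longrightarrow> ss r > 0"
  using rate_pos by (simp add: ss_def)

lemma dd_pos: "r > 0 \<Longrightarrow> dd r > 0"
  by (simp add: dd_def ss_pos cc_pos)

lemma cc_minus [simp]: "cc (- r) = cc r" and ss_minus [simp]: "ss (- r) = - ss r"
  and cc_0 [simp]: "cc 0 = 1" and ss_0 [simp]: "ss 0 = 0"
  by (simp_all add: cc_def ss_def)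

lemma cc_add: "cc (r + s) = cc r * cc s + ss r * ss s"
  by (simp add: cc_def ss_def cosh_add distrib_right)

lemma ss_add: "ss (r + s) = ss r * cc s + cc r * ss s"
  by (simp add: cc_def ss_def sinh_add distrib_right)

lemma cc_diff: "cc (r - s) = cc r * cc s - ss r * ss s"
  using cc_add[of r "- s"] by simp

lemma ss_diff: "ss (r - s) = ss r * cc s - cc r * ss s"
  using ss_add[of r "- s"] by simp

lemma cc_dd: "cc r * dd s = cc 1 / ss 1 * (ss (s + r) + ss (s - r))"
  by (simp add: dd_def ss_add ss_diff field_simps)

lemma dd_1: "dd 1 = 2 * cc 1"
  using ss_1_pos by (simp add: dd_def)

lemma cc_neighbours: "cc (r + 1) + cc (r - 1) = 2 * cc 1 * cc r"
  by (simp add: cc_add cc_diff)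

lemma cc_sq: "(cc r)\<^sup>2 = (ss r)\<^sup>2 + 1"
  by (simp add: cc_def ss_def cosh_square_eq)

lemma cc_2: "2 * cc 2 = real q - 2"
  using cc_add[of 1 1] cc_sq[of 1] by (simp add: q_eq power2_eq_square)

text \<open>Summing the recursion over the color of a new letter produces the left-hand side, one
  coefficient for each of the \<open>q\<close> colors; the colors of the two neighbours of that letter account for
  the three coefficients on the right.\<close>

lemma q_cc: "real q * cc r = cc (r - 2) + 2 * cc r + cc (r + 2)"
proof -
  have "cc (r - 2) + cc (r + 2) = 2 * cc 2 * cc r"
    by (simp add: cc_add[of r 2] cc_diff[of r 2])
  then show ?thesis by (simp add: cc_2 algebra_simps)
qed

lemma chebyshev_T_cosh: "poly (chebyshev_T n) (cc 1) = cc (real n)"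
proof (induction n rule: chebyshev_T.induct)
  case (3 n)
  have "cc (real n + 2) = 2 * cc 1 * cc (real n + 1) - cc (real n)"
    using cc_neighbours[of "real n + 1"] by (simp add: algebra_simps)
  then show ?case using 3 by (simp add: algebra_simps)
qed simp_all

lemma chebyshev_U_sinh: "poly (chebyshev_U n) (cc 1) = ss (real n + 1) / ss 1"
proof (induction n rule: chebyshev_U.induct)
  case 1
  then show ?case using ss_1_pos by simp
next
  case 2
  have "ss 2 = 2 * ss 1 * cc 1" using ss_add[of 1 1] by simp
  then show ?case using ss_1_pos by simp
next
  case (3 n)
  have "ss (real n + 3) = 2 * cc 1 * ss (real n + 2) - ss (real n + 1)"
    using ss_add[of "real n + 2" 1] ss_diff[of "real n + 2" 1] by (simp add: algebra_simps)
  then show ?case using 3 ss_1_pos by (simp add: field_simps)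
qed

lemma coeff_C_eq: "coeff_C q k = cc (real_of_int k)"
proof -
  have "coeff_C q k = cc \<bar>real_of_int k\<bar>"
    using chebyshev_T_cosh[of "nat \<bar>k\<bar>"] by (simp add: coeff_C_def cc_1)
  also have "\<dots> = cc (real_of_int k)" by (cases "k \<ge> 0") simp_all
  finally show ?thesis .
qed

lemma coeff_D_eq: "coeff_D q (Suc n) = dd (real n + 1)"
  using chebyshev_U_sinh[of n] by (simp add: coeff_D_def dd_def cc_1)

section \<open>The coloring of the line\<close>

abbreviation Ps :: "nat list \<Rightarrow> real" where "Ps \<equiv> Pstar q"

lemma Ps_Nil [simp]: "Ps [] = 1"
  by (subst Pstar.simps) simp

lemma Ps_improper: "\<not> distinct_adj xs \<Longrightarrow> Ps xs = 0"
  by (subst Pstar.simps) auto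

lemma Ps_rec:
  assumes "distinct_adj xs" "xs \<noteq> []"
  shows "dd (real (length xs) + 1) * Ps xs =
    (\<Sum>j<length xs. cc (real (length xs) - 1 - 2 * real j) * Ps (del (Suc j) xs))"
proof -
  let ?n = "length xs"
  have "(\<Sum>j\<in>{1..?n}. coeff_C q (int ?n - 2 * int j + 1) * Ps (del j xs)) =
      (\<Sum>j<?n. cc (real ?n - 1 - 2 * real j) * Ps (del (Suc j) xs))"
    by (rule sum.reindex_bij_witness[of _ Suc "\<lambda>j. j - 1"]) (auto simp: coeff_C_eq algebra_simps)
  moreover have "dd (real ?n + 1) > 0" by (rule dd_pos) simp
  ultimately show ?thesis using assms by (subst Pstar.simps) (simp add: coeff_D_eq)
qed

lemma Ps_nonneg: "Ps xs \<ge> 0"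
proof (induction xs rule: length_induct)
  case (1 xs)
  show ?case
  proof (cases "distinct_adj xs \<and> xs \<noteq> []")
    case True
    then have "dd (real (length xs) + 1) * Ps xs \<ge> 0"
      using 1 by (subst Ps_rec) (auto intro!: sum_nonneg mult_nonneg_nonneg less_imp_le[OF cc_pos])
    then show ?thesis using dd_pos[of "real (length xs) + 1"] by (simp add: zero_le_mult_iff)
  qed (use Ps_improper in fastforce)
qed

lemma Ps_rev: "Ps (rev xs) = Ps xs"
proof (induction xs rule: length_induct)
  case (1 xs)
  show ?case
  proof (cases "distinct_adj xs \<and> xs \<noteq> []")
    case True
    let ?n = "length xs"
    have "dd (real ?n + 1) * Ps (rev xs) =
        (\<Sum>j<?n. cc (real ?n - 1 - 2 * real j) * Ps (del (Suc j) (rev xs)))"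
      using Ps_rec[of "rev xs"] True by simp
    also have "\<dots> = (\<Sum>j<?n. cc (real ?n - 1 - 2 * real (?n - Suc j)) * Ps (del (Suc (?n - Suc j)) (rev xs)))"
      by (subst sum.nat_diff_reindex) simp
    also have "\<dots> = (\<Sum>j<?n. cc (real ?n - 1 - 2 * real j) * Ps (del (Suc j) xs))"
    proof (intro sum.cong refl)
      fix j assume "j \<in> {..<?n}"
      then have j: "j < ?n" by simp
      have "del (Suc (?n - Suc j)) (rev xs) = rev (del (Suc j) xs)"
        using j del_rev[of "?n - Suc j" xs] by simp
      moreover have "real ?n - 1 - 2 * real (?n - Suc j) = - (real ?n - 1 - 2 * real j)"
        using j by (simp add: of_nat_diff)
      ultimately show "cc (real ?n - 1 - 2 * real (?n - Suc j)) * Ps (del (Suc (?n - Suc j)) (rev xs)) =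
          cc (real ?n - 1 - 2 * real j) * Ps (del (Suc j) xs)"
        using 1 j by (simp only: cc_minus) simp
    qed
    also have "\<dots> = dd (real ?n + 1) * Ps xs" using Ps_rec[of xs] True by simp
    finally show ?thesis using dd_pos[of "real ?n + 1"] by simp
  next
    case False
    then show ?thesis by (cases "xs = []") (auto simp: Ps_improper)
  qed
qed

lemma Ps_map: "inj_on f (set xs) \<Longrightarrow> Ps (map f xs) = Ps xs"
proof (induction xs rule: length_induct)
  case (1 xs)
  have d: "distinct_adj (map f xs) \<longleftrightarrow> distinct_adj xs"
    using 1 by (metis distinct_adj_map_iff)
  show ?case
  proof (cases "distinct_adj xs \<and> xs \<noteq> []")
    case True
    have "Ps (del (Suc j) (map f xs)) = Ps (del (Suc j) xs)" if "j < length xs" for j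
    proof -
      have "length (del (Suc j) xs) < length xs" "inj_on f (set (del (Suc j) xs))"
        using that inj_on_subset[OF 1(2) set_del_subset] by simp_all
      then show ?thesis using 1(1) by (simp flip: map_del)
    qed
    then have "dd (real (length xs) + 1) * Ps (map f xs) = dd (real (length xs) + 1) * Ps xs"
      using True d Ps_rec[of xs] Ps_rec[of "map f xs"] by simp
    then show ?thesis using dd_pos[of "real (length xs) + 1"] by simp
  qed (use d Ps_improper in auto)
qed

text \<open>Expand every one-letter deletion by the recursion and, inductively, by this identity; the
  pair deletions then appear with the weight \<open>ss (1 + 2 * (k - j))\<close>, which changes sign when
  the two deletions are done in the other order.\<close>

lemma Ps_sinh_sum:
  "distinct_adj xs \<Longrightarrow>
    (\<Sum>j<length xs. ss (real (length xs) - 1 - 2 * real j) * Ps (del (Suc j) xs)) = 0"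
proof (induction xs rule: length_induct)
  case (1 xs)
  define n where "n = length xs"
  define a where "a j = real n - 1 - 2 * real j" for j :: nat
  define g where "g = (\<lambda>(j, k). ss (1 + 2 * (real k - real j)) * Ps (del (Suc k) (del (Suc j) xs)))"
  show ?case
  proof (cases "n \<le> 1")
    case True
    then have "n = 0 \<or> n = 1" by auto
    then show ?thesis by (auto simp flip: n_def)
  next
    case False
    have expand: "dd (real n) * (ss (a j) * Ps (del (Suc j) xs)) = (\<Sum>k<n - 1. g (j, k))" if j: "j < n" for j
    proof -
      define y where "y = del (Suc j) xs"
      have ly: "length y = n - 1" using j by (simp add: y_def n_def)
      have ny: "y \<noteq> []" using ly False by auto
      show ?thesis
      proof (cases "distinct_adj y")
        case True
        have r: "dd (real n) * Ps y = (\<Sum>k<n - 1. cc (real n - 2 - 2 * real k) * Ps (del (Suc k) y))"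
          using Ps_rec[OF True ny] False by (simp add: ly of_nat_diff algebra_simps)
        have s: "(\<Sum>k<n - 1. ss (real n - 2 - 2 * real k) * Ps (del (Suc k) y)) = 0"
        proof -
          have "length y < length xs" using ly False by (simp add: n_def)
          then have "(\<Sum>k<length y. ss (real (length y) - 1 - 2 * real k) * Ps (del (Suc k) y)) = 0"
            using 1(1) True by blast
          moreover have "real (length y) - 1 = real n - 2"
            using ly False by (simp add: of_nat_diff)
          ultimately show ?thesis by (simp only: ly)
        qed
        have "dd (real n) * (ss (a j) * Ps y) =
            ss (a j) * (\<Sum>k<n - 1. cc (real n - 2 - 2 * real k) * Ps (del (Suc k) y)) -
            cc (a j) * (\<Sum>k<n - 1. ss (real n - 2 - 2 * real k) * Ps (del (Suc k) y))"
          using r s by simp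
        also have "\<dots> = (\<Sum>k<n - 1. ss (a j - (real n - 2 - 2 * real k)) * Ps (del (Suc k) y))"
          by (simp only: ss_diff sum_distrib_left flip: sum_subtractf) (simp add: algebra_simps)
        also have "\<dots> = (\<Sum>k<n - 1. g (j, k))"
          by (simp add: g_def a_def y_def algebra_simps)
        finally show ?thesis by (simp add: y_def)
      next
        case False
        then obtain u b c v where uv: "xs = u @ b # c # b # v" "j = Suc (length u)"
          using improper_del_cases[of xs j] 1(2) j unfolding y_def n_def by blast
        then have y: "y = u @ b # b # v"
          using del_append_right[of u 1 "b # c # b # v"] by (simp add: y_def)
        have "(\<Sum>k<n - 1. g (j, k)) = (\<Sum>k<length (u @ b # b # v).
            ss (1 + 2 * (real k - real j)) * Ps (del (Suc k) (u @ b # b # v)))"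
          unfolding g_def y[symmetric] ly by (simp add: y_def)
        \<comment> \<open>The two surviving weights are \<open>ss (- 1)\<close> and \<open>ss 1\<close>.\<close>
        also have "\<dots> = 0"
          by (subst sum_del_repeat) (simp_all add: Ps_improper uv(2) del: length_append)
        finally show ?thesis using False Ps_improper by (simp add: y_def)
      qed
    qed
    \<comment> \<open>Deleting first \<open>j\<close> and then \<open>k\<close> is deleting the same two letters in the other order, where the
      later index shifts by one.\<close>
    define \<phi> where "\<phi> = (\<lambda>(j::nat, k). if j \<le> k then (Suc k, j) else (k, j - 1))"
    have "sum g ({..<n} \<times> {..<n - 1}) = 0"
    proof (rule sum_antisymmetric_zero[of _ \<phi>])
      fix x assume "x \<in> {..<n} \<times> {..<n - 1}"
      then obtain j k where x: "x = (j, k)" and jk: "j < n" "k < n - 1" by auto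
      show "\<phi> x \<in> {..<n} \<times> {..<n - 1}" "\<phi> (\<phi> x) = x" using jk by (auto simp: x \<phi>_def)
      show "g (\<phi> x) = - g x"
      proof (cases "j \<le> k")
        case True
        have "1 + 2 * (real j - real (Suc k)) = - (1 + 2 * (real k - real j))" by simp
        then have "ss (1 + 2 * (real j - real (Suc k))) = - ss (1 + 2 * (real k - real j))"
          by (simp only: ss_minus)
        then show ?thesis using True del_del[of j k xs] jk by (simp add: x \<phi>_def g_def n_def)
      next
        case False
        then obtain j' where j': "j = Suc j'" by (cases j) auto
        have "1 + 2 * (real j' - real k) = - (1 + 2 * (real k - real (Suc j')))" by simp
        then have "ss (1 + 2 * (real j' - real k)) = - ss (1 + 2 * (real k - real (Suc j')))"
          by (simp only: ss_minus)
        then show ?thesis using False del_del[of k j' xs] jk by (simp add: x \<phi>_def g_def n_def j')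
      qed
    qed
    then have "(\<Sum>j<n. \<Sum>k<n - 1. g (j, k)) = 0" by (simp add: sum.cartesian_product)
    then have "dd (real n) * (\<Sum>j<n. ss (a j) * Ps (del (Suc j) xs)) = 0"
      using expand by (simp add: sum_distrib_left)
    moreover have "dd (real n) > 0" using False by (intro dd_pos) simp
    ultimately show ?thesis by (simp add: n_def a_def)
  qed
qed

text \<open>By the addition theorem for \<open>cosh\<close>, shifted weights are a combination of those of the
  recursion and those of its companion, and the latter sum vanishes.  The extra term for the
  empty word is what a missing neighbour leaves over when the color of a new letter is summed out.\<close>

lemma Ps_shifted_sum:
  assumes "distinct_adj y"
  shows "(\<Sum>j<length y. cc (real (length y) - 1 - 2 * real j + h) * Ps (del (Suc j) y)) +
      (if y = [] then cc (h + 1) + cc (h - 1) else 0) = cc h * dd (real (length y) + 1) * Ps y"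
proof (cases "y = []")
  case True
  then show ?thesis by (simp add: cc_neighbours dd_1)
next
  case False
  have "(\<Sum>j<length y. cc (real (length y) - 1 - 2 * real j + h) * Ps (del (Suc j) y)) =
      cc h * (\<Sum>j<length y. cc (real (length y) - 1 - 2 * real j) * Ps (del (Suc j) y)) +
      ss h * (\<Sum>j<length y. ss (real (length y) - 1 - 2 * real j) * Ps (del (Suc j) y))"
    by (simp only: cc_add sum_distrib_left flip: sum.distrib) (simp add: algebra_simps)
  then show ?thesis using Ps_rec[OF assms False] Ps_sinh_sum[OF assms] False by simp
qed

text \<open>The two instances of interest are the line, with no forbidden first letter, and the long
  arm of the star below two differently colored leaves, whose colors are the forbidden ones.

  The proof is by induction on the total length.  Apply the recursion to \<open>x @ a # y\<close> and sum over \<open>a\<close>.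
  Deletions inside \<open>x\<close> or \<open>y\<close> are evaluated by induction, and the deletion of \<open>a\<close> itself gives
  the value at \<open>x @ y\<close>, once for each color.  The recursion is false for the bad letters \<open>a\<close>, those that
  repeat a neighbour or are forbidden, and there its right-hand side is again a multiple of the value
  at \<open>x @ y\<close>.  The coefficients of this value cancel by \<open>q_cc\<close>, and what is left of the two sums
  over deletions are the recursions of \<open>Q\<close> at \<open>x\<close> and of \<open>P\<^sup>*\<close> at \<open>y\<close>.

  The assumption \<open>start\<close> concerns an empty \<open>x\<close>, which has no recursion of its own.  There \<open>a\<close> has no left
  neighbour, but \<open>card F\<close> forbidden values instead; with two of them the loss is as for a neighbour,
  and with none the missing term is supplied by \<open>Q w = Q [] * Ps w\<close>.\<close>

lemma deletion_functional_factors: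
  fixes Q :: "nat list \<Rightarrow> real" and F :: "nat set"
  defines "\<nu> N \<equiv> cc 1 / ss 1 * (ss (2 * real N + 1) + (1 - real (card F)) * ss 1)"
  assumes F: "F \<subseteq> {1..q}" "card F \<le> 2"
    and improper: "\<And>w. \<not> distinct_adj w \<Longrightarrow> Q w = 0"
    and forbidden: "\<And>a w. a \<in> F \<Longrightarrow> Q (a # w) = 0"
    and rec: "\<And>w. distinct_adj w \<Longrightarrow> w \<noteq> [] \<Longrightarrow> hd w \<notin> F \<Longrightarrow> set w \<subseteq> {1..q} \<Longrightarrow>
      \<nu> (length w) * Q w = (\<Sum>i<length w. cc (2 * real i + 1) * Q (del (Suc i) w))"
    and start: "\<And>w. set w \<subseteq> {1..q} \<Longrightarrow> (2 - real (card F)) * Q w = (2 - real (card F)) * (Q [] * Ps w)"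
    and colors: "set x \<subseteq> {1..q}" "set y \<subseteq> {1..q}"
  shows "(\<Sum>a\<in>{1..q}. Q (x @ a # y)) = Q x * Ps y"
  using colors
proof (induction "length x + length y" arbitrary: x y rule: less_induct)
  case less
  define good where "good w \<longleftrightarrow> distinct_adj w \<and> (w = [] \<or> hd w \<notin> F)" for w
  have bad: "Q w = 0" if "\<not> good w" for w
    using that improper forbidden unfolding good_def by (cases w) auto
  have finF: "finite F" using F(1) finite_subset by blast
  show ?case
  proof (cases "good x \<and> distinct_adj y")
    case False
    then have "\<not> good (x @ a # y)" for a
      by (cases x) (auto simp: good_def distinct_adj_append_iff distinct_adj_Cons)
    moreover have "Q x * Ps y = 0" using False bad Ps_improper by auto
    ultimately show ?thesis using bad by simp
  next
    case True
    then have gx: "good x" and py: "distinct_adj y" by auto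
    define m n where "m = length x" and "n = length y"
    \<comment> \<open>The right-hand side of the recursion, for bad letters \<open>a\<close> as well; \<open>L\<close> and \<open>Y\<close> are the letters
      that are bad because of what precedes and what follows.\<close>
    define R where "R a = (\<Sum>i<length (x @ a # y). cc (2 * real i + 1) * Q (del (Suc i) (x @ a # y)))" for a
    define B where "B = Q (x @ y)"
    define Sx where "Sx = (\<Sum>i<m. cc (2 * real i + 1) * Q (del (Suc i) x))"
    define Sy where "Sy = (\<Sum>j<n. cc (2 * real m + 3 + 2 * real j) * Ps (del (Suc j) y))"
    define k where "k = 2 * real m + 1"
    define cx where "cx = (if x = [] then cc 1 else cc (k - 2) + cc k)"
    define cy where "cy = cc k + cc (k + 2)"
    define L where "L = {a \<in> {1..q}. if x = [] then a \<in> F else a = last x}"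
    define Y where "Y = {a \<in> {1..q}. y \<noteq> [] \<and> a = hd y}"

    have R: "R a = (\<Sum>i<m. cc (2 * real i + 1) * Q (del (Suc i) x @ a # y)) + cc k * B +
        (\<Sum>j<n. cc (2 * real m + 3 + 2 * real j) * Q (x @ a # del (Suc j) y))" for a
      unfolding R_def sum_del_append[of "\<lambda>j w. cc (2 * real j + 1) * Q w" x]
        sum_del_Cons[of "\<lambda>j w. cc (2 * real (length x + j) + 1) * Q (x @ w)"]
      by (simp add: m_def n_def k_def B_def algebra_simps)
    have sumR: "sum R {1..q} = Sx * Ps y + real q * cc k * B + Q x * Sy"
    proof -
      have 1: "(\<Sum>a\<in>{1..q}. Q (del (Suc i) x @ a # y)) = Q (del (Suc i) x) * Ps y" if "i < m" for i
        using that less.prems set_del_subset[of "Suc i" x]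
        by (intro less.hyps) (auto simp: m_def)
      have 2: "(\<Sum>a\<in>{1..q}. Q (x @ a # del (Suc j) y)) = Q x * Ps (del (Suc j) y)" if "j < n" for j
        using that less.prems set_del_subset[of "Suc j" y]
        by (intro less.hyps) (auto simp: n_def)
      have "sum R {1..q} = (\<Sum>i<m. cc (2 * real i + 1) * (\<Sum>a\<in>{1..q}. Q (del (Suc i) x @ a # y))) +
          real q * cc k * B +
          (\<Sum>j<n. cc (2 * real m + 3 + 2 * real j) * (\<Sum>a\<in>{1..q}. Q (x @ a # del (Suc j) y)))"
        unfolding R sum.distrib sum_distrib_left
        by (subst (1 2) sum.swap) simp
      also have "\<dots> = Sx * Ps y + real q * cc k * B + Q x * Sy"
        using 1 2 by (simp add: Sx_def Sy_def sum_distrib_right sum_distrib_left mult_ac)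
      finally show ?thesis .
    qed

    have good_iff: "good (x @ a # y) \<longleftrightarrow> a \<notin> L \<union> Y" if "a \<in> {1..q}" for a
    proof -
      have "hd (x @ a # y) = (if x = [] then a else hd x)" by simp
      then show ?thesis using gx py that
        unfolding good_def L_def Y_def distinct_adj_append_iff distinct_adj_Cons by auto
    qed
    have RL: "R a = cx * B" if "a \<in> L" for a
    proof (cases "x = []")
      case True
      then have "a \<in> F" using that by (simp add: L_def)
      then show ?thesis using True by (simp add: R forbidden m_def cx_def k_def)
    next
      case False
      then have "x = butlast x @ [a]" using that by (simp add: L_def)
      then obtain u where x: "x = u @ [a]" by blast
      have "R a = (cc (2 * real (length u) + 1) + cc (2 * real (Suc (length u)) + 1)) * B"
        using sum_del_repeat[where u = u and v = y and f = "\<lambda>i. cc (2 * real i + 1)", OF improper]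
        by (simp only: R_def B_def x append.assoc append_Cons append_Nil)
      then show ?thesis by (simp add: x m_def cx_def k_def algebra_simps)
    qed
    have RY: "R a = cy * B" if "a \<in> Y" for a
    proof -
      have "y = a # tl y" using that by (simp add: Y_def)
      then obtain v where y: "y = a # v" by blast
      have "R a = (cc (2 * real m + 1) + cc (2 * real (Suc m) + 1)) * B"
        using sum_del_repeat[where u = x and v = v and f = "\<lambda>i. cc (2 * real i + 1)", OF improper]
        by (simp only: R_def B_def y m_def)
      then show ?thesis by (simp add: cy_def k_def algebra_simps)
    qed
    have LY: "R a = 0" if "a \<in> L \<inter> Y" for a
    proof -
      have "\<not> good (x @ y)"
        using that by (cases "x = []") (auto simp: good_def L_def Y_def distinct_adj_append_iff)
      then show ?thesis using RY[of a] that bad by (simp add: B_def)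
    qed
    have cardL: "real (card L) = (if x = [] then real (card F) else 1)"
    proof -
      have "x \<noteq> [] \<Longrightarrow> last x \<in> {1..q}"
        using less.prems(1) last_in_set[of x] by blast
      then have "L = (if x = [] then F else {last x})"
        using F(1) by (auto simp: L_def)
      then show ?thesis by simp
    qed
    have cardY: "real (card Y) = (if y = [] then 0 else 1)"
    proof -
      have "y \<noteq> [] \<Longrightarrow> hd y \<in> {1..q}"
        using less.prems(2) hd_in_set[of y] by blast
      then have "Y = (if y = [] then {} else {hd y})"
        by (auto simp: Y_def)
      then show ?thesis by simp
    qed
    have sumbad: "sum R (L \<union> Y) = real (card L) * cx * B + real (card Y) * cy * B"
    proof -
      have "sum R (L \<union> Y) = sum R L + sum R Y - sum R (L \<inter> Y)"
        by (rule sum_Un) (auto simp: L_def Y_def)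
      moreover have "sum R (L \<inter> Y) = 0" using LY by (intro sum.neutral) blast
      moreover have "sum R L = real (card L) * (cx * B)" "sum R Y = real (card Y) * (cy * B)"
        using RL RY by simp_all
      ultimately show ?thesis by (simp only: mult.assoc)
    qed

    define N where "N = m + n + 1"
    have len: "length (x @ a # y) = N" for a by (simp add: N_def m_def n_def)
    have summand: "\<nu> N * Q (x @ a # y) = (if a \<in> L \<union> Y then 0 else R a)" if a: "a \<in> {1..q}" for a
    proof (cases "good (x @ a # y)")
      case True
      then have "\<nu> (length (x @ a # y)) * Q (x @ a # y) = R a" unfolding R_def
        using a less.prems by (intro rec) (auto simp: good_def)
      then show ?thesis using good_iff[OF a] True by (simp only: len) simp
    next
      case False
      then show ?thesis using good_iff[OF a] bad[OF False] by simp
    qed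
    have "\<nu> N * (\<Sum>a\<in>{1..q}. Q (x @ a # y)) = (\<Sum>a\<in>{1..q}. if a \<in> L \<union> Y then 0 else R a)"
      using summand by (simp add: sum_distrib_left)
    also have "\<dots> = sum R ({1..q} - (L \<union> Y))"
      by (rule sum.mono_neutral_cong_right) auto
    also have "\<dots> = sum R {1..q} - sum R (L \<union> Y)"
      by (rule sum_diff) (auto simp: L_def Y_def)
    also have "\<dots> = Sx * Ps y + Q x * Sy + B * (real q * cc k - real (card L) * cx - real (card Y) * cy)"
      unfolding sumR sumbad by (simp add: algebra_simps)
    also have "real q * cc k - real (card L) * cx - real (card Y) * cy =
        (if x = [] then (2 - real (card F)) * cc 1 else 0) + (if y = [] then cy else 0)"
    proof -
      have "cc (k - 2) + cc k = 2 * cc 1" if "x = []"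
        using that cc_minus[of 1] by (simp add: k_def m_def)
      then show ?thesis unfolding cardL cardY q_cc[of k]
        by (simp add: cx_def cy_def algebra_simps)
    qed
    also have "Sx * Ps y + Q x * Sy +
        B * ((if x = [] then (2 - real (card F)) * cc 1 else 0) + (if y = [] then cy else 0)) =
        (Sx + (if x = [] then (2 - real (card F)) * cc 1 * Q [] else 0)) * Ps y +
        Q x * (Sy + (if y = [] then cy else 0))"
    proof -
      have "B * (if x = [] then (2 - real (card F)) * cc 1 else 0) =
          (if x = [] then (2 - real (card F)) * cc 1 * Q [] else 0) * Ps y"
        using start[OF less.prems(2)] by (auto simp: B_def)
      moreover have "B * (if y = [] then cy else 0) = Q x * (if y = [] then cy else 0)"
        by (simp add: B_def)
      ultimately show ?thesis by (simp add: algebra_simps)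
    qed
    also have "Sx + (if x = [] then (2 - real (card F)) * cc 1 * Q [] else 0) = \<nu> m * Q x"
    proof (cases "x = []")
      case True
      then show ?thesis using ss_1_pos by (simp add: Sx_def m_def \<nu>_def field_simps)
    next
      case False
      then show ?thesis using rec[of x] gx less.prems(1) by (simp add: Sx_def m_def good_def)
    qed
    also have "Sy + (if y = [] then cy else 0) = cc (k + 1 + real n) * dd (real n + 1) * Ps y"
    proof -
      \<comment> \<open>The shift that makes the weights continue those of \<open>x\<close>, up to the sign of the argument.\<close>
      define h where "h = - (k + 1 + real n)"
      have "cc (real n - 1 - 2 * real j + h) = cc (2 * real m + 3 + 2 * real j)" for j
        using cc_minus[of "2 * real m + 3 + 2 * real j"] by (simp add: h_def k_def algebra_simps)
      moreover have "cc (h + 1) + cc (h - 1) = cy" if "y = []"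
        using that cc_minus[of k] cc_minus[of "k + 2"] by (simp add: h_def n_def cy_def algebra_simps)
      moreover have "cc h = cc (k + 1 + real n)" by (simp only: h_def cc_minus)
      ultimately show ?thesis
        using Ps_shifted_sum[OF py, of h] by (cases "y = []") (simp_all add: Sy_def n_def)
    qed
    also have "\<nu> m * Q x * Ps y + Q x * (cc (k + 1 + real n) * dd (real n + 1) * Ps y) =
        (\<nu> m + cc (k + 1 + real n) * dd (real n + 1)) * (Q x * Ps y)"
      by (simp add: algebra_simps)
    also have "\<nu> m + cc (k + 1 + real n) * dd (real n + 1) = \<nu> N"
    proof -
      have "real n + 1 - (k + 1 + real n) = - k" by simp
      then have "cc (k + 1 + real n) * dd (real n + 1) = cc 1 / ss 1 * (ss (2 * real N + 1) - ss k)"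
        unfolding cc_dd by (simp only: ss_minus) (simp add: k_def N_def algebra_simps)
      then show ?thesis by (simp add: \<nu>_def k_def algebra_simps)
    qed
    finally have "\<nu> N * (\<Sum>a\<in>{1..q}. Q (x @ a # y)) = \<nu> N * (Q x * Ps y)" .
    moreover have "\<nu> N > 0"
    proof -
      have "ss (2 * real N + 1) > ss 1"
        using rate_pos by (simp add: ss_def N_def)
      moreover have "(1 - real (card F)) * ss 1 \<ge> - ss 1"
        using F(2) ss_1_pos by (cases "card F = 2") (auto simp: algebra_simps)
      ultimately show ?thesis unfolding \<nu>_def using cc_pos[of 1] ss_1_pos by simp
    qed
    ultimately show ?thesis by simp
  qed
qed

text \<open>Shifting the recursion of a word by its length turns the weights into \<open>C(1), C(3), \<dots>\<close>.\<close>

lemma Ps_factors: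
  assumes "set x \<subseteq> {1..q}" "set y \<subseteq> {1..q}"
  shows "(\<Sum>a\<in>{1..q}. Ps (x @ a # y)) = Ps x * Ps y"
proof (rule deletion_functional_factors[where F = "{}"])
  fix w :: "nat list" assume w: "distinct_adj w" "w \<noteq> []"
  have "cc (real (length w) - 1 - 2 * real j + - real (length w)) = cc (2 * real j + 1)" for j :: nat
    using cc_minus[of "2 * real j + 1"] by (simp add: algebra_simps)
  then have "(\<Sum>i<length w. cc (2 * real i + 1) * Ps (del (Suc i) w)) =
      cc (real (length w)) * dd (real (length w) + 1) * Ps w"
    using Ps_shifted_sum[OF w(1), of "- real (length w)"] w(2) by simp
  also have "cc (real (length w)) * dd (real (length w) + 1) =
      cc 1 / ss 1 * (ss (2 * real (length w) + 1) + ss 1)"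
    unfolding cc_dd by (simp add: algebra_simps)
  finally show "cc 1 / ss 1 * (ss (2 * real (length w) + 1) + (1 - real (card ({} :: nat set))) * ss 1) * Ps w =
      (\<Sum>i<length w. cc (2 * real i + 1) * Ps (del (Suc i) w))" by simp
qed (use assms Ps_improper in auto)

lemma Ps_sum_last: "set x \<subseteq> {1..q} \<Longrightarrow> (\<Sum>a\<in>{1..q}. Ps (x @ [a])) = Ps x"
  using Ps_factors[of x "[]"] by simp

lemma Ps_sum_first: "set y \<subseteq> {1..q} \<Longrightarrow> (\<Sum>a\<in>{1..q}. Ps (a # y)) = Ps y"
  using Ps_factors[of "[]" y] by simp

text \<open>The recursion for \<open>a # y\<close> and the recursion for \<open>y\<close> shifted by \<open>- 1\<close> give the same weights to the
  deletions in \<open>y\<close>, so the bound is inherited from shorter words as soon as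
  \<open>cosh n * cosh 1 \<le> cosh (n + 1)\<close>.  For a proper nonempty \<open>y\<close> the ratio is \<open>1 / (q - 1)\<close> on average over the
  admissible \<open>a\<close>; the constant \<open>2 / q\<close> is good enough for positivity at \<open>q = 5\<close>.\<close>

lemma Ps_Cons_le: "Ps (a # y) \<le> 2 / real q * Ps y"
proof (induction y rule: length_induct)
  case (1 y)
  define n where "n = length y"
  show ?case
  proof (cases "distinct_adj (a # y)")
    case False
    then show ?thesis using Ps_nonneg[of y] by (simp add: Ps_improper)
  next
    case True
    have py: "distinct_adj y" using True by (auto simp: distinct_adj_Cons)
    have "dd (real n + 2) * Ps (a # y) =
        cc (real n) * Ps y + (\<Sum>j<n. cc (real n - 2 - 2 * real j) * Ps (a # del (Suc j) y))"
      using Ps_rec[OF True]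
      unfolding sum_del_Cons[of "\<lambda>j w. cc (real (length (a # y)) - 1 - 2 * real j) * Ps w"]
      by (simp add: n_def algebra_simps)
    also have "\<dots> \<le> cc (real n) * Ps y +
        (\<Sum>j<n. cc (real n - 2 - 2 * real j) * (2 / real q * Ps (del (Suc j) y)))"
      using 1 by (intro add_left_mono sum_mono mult_left_mono less_imp_le[OF cc_pos]) (auto simp: n_def)
    also have "(\<Sum>j<n. cc (real n - 2 - 2 * real j) * (2 / real q * Ps (del (Suc j) y))) =
        2 / real q * (\<Sum>j<n. cc (real n - 1 - 2 * real j + - 1) * Ps (del (Suc j) y))"
      by (simp add: sum_distrib_left algebra_simps)
    also have "\<dots> \<le> 2 / real q * (cc 1 * dd (real n + 1) * Ps y)"
      using Ps_shifted_sum[OF py, of "- 1"] cc_pos[of "- 1 + 1"] cc_pos[of "- 1 - 1"]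
      by (intro mult_left_mono) (auto simp: n_def split: if_splits)
    finally have *: "dd (real n + 2) * Ps (a # y) \<le> (cc (real n) + 2 / real q * cc 1 * dd (real n + 1)) * Ps y"
      by (simp add: algebra_simps)
    have "dd (real n + 2) = cc 1 * dd (real n + 1) + 2 * cc 1 * cc (real n + 1)"
      using ss_add[of "real n + 1" 1] ss_1_pos by (simp add: dd_def field_simps)
    moreover have "cc (real n) * cc 1 \<le> cc (real n + 1)"
      using cc_add[of "real n" 1] ss_nonneg[of "real n"] ss_1_pos by simp
    then have "cc (real n) \<le> 2 / real q * (2 * cc 1 * cc (real n + 1))"
      using cc_pos[of 1] by (simp add: q_eq field_simps power2_eq_square)
    ultimately have "cc (real n) + 2 / real q * cc 1 * dd (real n + 1) \<le> 2 / real q * dd (real n + 2)"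
      by (simp add: distrib_left mult.assoc)
    then have "(cc (real n) + 2 / real q * cc 1 * dd (real n + 1)) * Ps y \<le> 2 / real q * dd (real n + 2) * Ps y"
      by (intro mult_right_mono Ps_nonneg)
    with * have "dd (real n + 2) * Ps (a # y) \<le> dd (real n + 2) * (2 / real q * Ps y)"
      by (simp only: mult_ac)
    then show ?thesis by (rule mult_left_le_imp_le) (simp add: dd_pos)
  qed
qed

section \<open>The center and the long arm, given the two leaves\<close>

lemma ss_3: "ss 3 = ss 1 * (real q - 1)"
proof -
  have "ss 3 = ss 1 * (2 * (cc 1)\<^sup>2 + cc 2)"
    using ss_add[of 2 1] ss_add[of 1 1] by (simp add: algebra_simps power2_eq_square)
  also have "2 * (cc 1)\<^sup>2 + cc 2 = real q - 1" using q_eq cc_2 by linarith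
  finally show ?thesis .
qed

lemma cc_3: "cc 3 = (real q - 3) * cc 1"
  using q_cc[of 1] cc_minus[of 1] by (simp add: algebra_simps)

lemma dd_2: "dd 2 = real q"
  using ss_add[of 1 1] ss_1_pos by (simp add: dd_def q_eq power2_eq_square)

lemma dd_3: "dd 3 = 2 * cc 1 * (real q - 1)"
  using ss_1_pos by (simp add: dd_def ss_3)

lemma dd_4: "dd 4 = real q * (real q - 2)"
  using ss_add[of 2 2] cc_2 by (simp add: dd_def flip: dd_2)

lemma Ps_1: "Ps [a] = 1 / real q"
  using Ps_rec[of "[a]"] q5 by (simp add: dd_2 field_simps)

lemma Ps_2:
  assumes "a \<noteq> b"
  shows "Ps [a, b] = 1 / (real q * (real q - 1))"
proof -
  have "2 * cc 1 * ((real q - 1) * Ps [a, b]) = 2 * cc 1 * (1 / real q)"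
    using Ps_rec[of "[a, b]"] assms cc_minus[of 1] by (simp add: dd_3 Ps_1 lessThan_Suc)
  moreover have "2 * cc 1 \<noteq> 0" using cc_pos[of 1] by simp
  ultimately have "(real q - 1) * Ps [a, b] = 1 / real q" by (simp only: mult_cancel_left simp_thms)
  then show ?thesis using q5 by (simp add: field_simps)
qed

lemma Ps_3:
  assumes "a \<noteq> b" "b \<noteq> c"
  shows "Ps [a, b, c] = (if a = c then 1 / (real q ^ 2 * (real q - 1)) else 1 / (real q ^ 2 * (real q - 2)))"
proof -
  have "real q * (real q - 2) * Ps [a, b, c] = (real q - 2) * (1 / (real q * (real q - 1))) + Ps [a, c]"
    using Ps_rec[of "[a, b, c]"] assms cc_2 cc_minus[of 2]
    by (simp add: dd_4 lessThan_Suc Ps_2 add_divide_distrib[symmetric])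
  moreover have "Ps [a, c] = (if a = c then 0 else 1 / (real q * (real q - 1)))"
    using Ps_2 Ps_improper by auto
  ultimately show ?thesis using q5
    by (simp add: divide_simps power2_eq_square split: if_splits) (simp_all add: algebra_simps)
qed

text \<open>The color of the center is the first letter of the word, which makes its deletion one of the
  deletions of the recursion.  The value at the empty word is the probability of the two leaf colors,
  and with it the recursion also covers words of length one.\<close>

definition star_word :: "nat \<Rightarrow> nat \<Rightarrow> nat list \<Rightarrow> real" where
  "star_word l r w = (case w of [] \<Rightarrow> 1 / real q ^ 2 | z # xs \<Rightarrow> P_star_graph q l z r xs)"

lemma star_word_Nil [simp]: "star_word l r [] = 1 / real q ^ 2"
  by (simp add: star_word_def)

lemma star_word_single: "star_word l r [z] = Ps [l, z, r]"
  by (simp add: star_word_def P_star_graph.simps)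

lemma star_word_improper: "\<not> distinct_adj w \<Longrightarrow> star_word l r w = 0"
  by (cases w) (auto simp: star_word_def P_star_graph.simps proper_star_coloring_iff)

lemma star_word_forbidden: "z \<in> {l, r} \<Longrightarrow> star_word l r (z # xs) = 0"
  by (subst star_word_def, subst list.case, subst P_star_graph.simps)
    (auto simp: proper_star_coloring_iff Ps_improper)

text \<open>The term of the definition that replaces the center by its neighbour on the long arm is the
  summand \<open>i = 0\<close>.\<close>

lemma star_word_rec:
  assumes "l \<noteq> r" "distinct_adj w" "w \<noteq> []" "hd w \<notin> {l, r}"
  shows "cc (real (length w) + 1) * dd (real (length w)) * star_word l r w =
    (\<Sum>i<length w. cc (2 * real i + 1) * star_word l r (del (Suc i) w))"
proof -
  obtain z xs where w: "w = z # xs" using assms(3) by (cases w) auto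
  show ?thesis
  proof (cases xs)
    case Nil
    have "cc 2 * dd 1 * (1 / (real q ^ 2 * (real q - 2))) = cc 1 / real q ^ 2"
    proof -
      have "cc 2 * dd 1 = (real q - 2) * cc 1" by (simp add: dd_1 flip: cc_2)
      then show ?thesis using q5 by simp
    qed
    then show ?thesis using assms w Nil by (simp add: star_word_single Ps_3)
  next
    case (Cons x xs')
    let ?n = "length xs"
    have proper: "proper_coloring (star_edges (length xs)) (star_coloring l z r xs)"
      using assms w by (auto simp: proper_star_coloring_iff)
    have sum: "(\<Sum>i\<in>{1..?n}. coeff_C q (2 * int i + 1) * P_star_graph q l z r (del i xs)) =
        (\<Sum>i<?n. cc (2 * real (Suc i) + 1) * star_word l r (z # del (Suc i) xs))"
      by (rule sum.reindex_bij_witness[of _ Suc "\<lambda>j. j - 1"]) (auto simp: coeff_C_eq star_word_def algebra_simps)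
    have first: "coeff_C q 1 * P_star_graph q l (xs ! 0) r (del 1 xs) = cc 1 * star_word l r xs"
      using Cons by (simp add: coeff_C_eq star_word_def)
    have pos: "cc (real ?n + 2) * dd (real ?n + 1) \<noteq> 0"
      using cc_pos[of "real ?n + 2"] dd_pos[of "real ?n + 1"] by simp
    have "star_word l r w = (cc 1 * star_word l r xs +
        (\<Sum>i<?n. cc (2 * real (Suc i) + 1) * star_word l r (z # del (Suc i) xs))) /
        (cc (real ?n + 2) * dd (real ?n + 1))"
      unfolding w star_word_def list.case
      using Cons proper assms(1) sum first coeff_D_eq[of ?n] coeff_C_eq[of "int ?n + 2"]
      by (subst P_star_graph.simps) (simp add: star_word_def add_ac)
    also have "cc 1 * star_word l r xs +
        (\<Sum>i<?n. cc (2 * real (Suc i) + 1) * star_word l r (z # del (Suc i) xs)) =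
        (\<Sum>i<length w. cc (2 * real i + 1) * star_word l r (del (Suc i) w))"
      unfolding w sum_del_Cons[of "\<lambda>i v. cc (2 * real i + 1) * star_word l r v"] by simp
    finally show ?thesis using pos by (simp add: w add_ac)
  qed
qed

lemma star_word_factors_distinct:
  assumes "l \<noteq> r" "l \<in> {1..q}" "r \<in> {1..q}" "set x \<subseteq> {1..q}" "set y \<subseteq> {1..q}"
  shows "(\<Sum>a\<in>{1..q}. star_word l r (x @ a # y)) = star_word l r x * Ps y"
proof (rule deletion_functional_factors[where F = "{l, r}"])
  fix w assume "distinct_adj w" "w \<noteq> []" "hd w \<notin> {l, r}"
  note star_word_rec[OF assms(1) this]
  moreover have "cc (real (length w) + 1) * dd (real (length w)) =
      cc 1 / ss 1 * (ss (2 * real (length w) + 1) - ss 1)"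
    unfolding cc_dd using ss_minus[of 1] by (simp add: algebra_simps del: ss_minus)
  ultimately show "cc 1 / ss 1 * (ss (2 * real (length w) + 1) + (1 - real (card {l, r})) * ss 1) *
      star_word l r w = (\<Sum>i<length w. cc (2 * real i + 1) * star_word l r (del (Suc i) w))"
    using assms(1) by simp
qed (use assms star_word_improper star_word_forbidden in auto)

text \<open>The definition for equal leaf colors is made for this; forbidden colors contribute nothing.\<close>

lemma star_word_sum_right:
  assumes "l \<in> {1..q}" "set w \<subseteq> {1..q}"
  shows "(\<Sum>r\<in>{1..q}. star_word l r w) = Ps (l # w)"
proof (cases w)
  case Nil
  then show ?thesis using q5 by (simp add: Ps_1 power2_eq_square)
next
  case w: (Cons z xs)
  show ?thesis
  proof (cases "xs = [] \<or> \<not> distinct_adj (l # w)")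
    case True
    then show ?thesis
    proof
      assume "xs = []"
      then show ?thesis using Ps_sum_last[of "[l, z]"] assms w by (simp add: star_word_single)
    next
      assume i: "\<not> distinct_adj (l # w)"
      then have "star_word l r w = 0" for r
        using star_word_improper[of w l r] star_word_forbidden[of z l r xs] by (auto simp: w)
      then show ?thesis using i by (simp add: Ps_improper)
    qed
  next
    case False
    then have "proper_coloring (star_edges (length xs)) (star_coloring l z l xs)"
      by (auto simp: proper_star_coloring_iff w)
    then have eq: "star_word l l w = Ps (l # w) - (\<Sum>r\<in>{1..q} - {z, l}. star_word l r w)"
      using False unfolding w star_word_def list.case by (subst P_star_graph.simps) simp
    have "(\<Sum>r\<in>{1..q}. star_word l r w) = (\<Sum>r\<in>{1..q} - {z, l}. star_word l r w) + (\<Sum>r\<in>{z, l}. star_word l r w)"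
      using assms by (intro sum.subset_diff) (auto simp: w)
    also have "(\<Sum>r\<in>{z, l}. star_word l r w) = star_word l l w"
      using False star_word_forbidden[of z l z xs] by (auto simp: w)
    finally show ?thesis using eq by simp
  qed
qed

lemma star_word_equal:
  assumes "l \<in> {1..q}" "set w \<subseteq> {1..q}"
  shows "star_word l l w = Ps (l # w) - (\<Sum>r\<in>{1..q} - {l}. star_word l r w)"
  using star_word_sum_right[OF assms] sum.remove[of "{1..q}" l "\<lambda>r. star_word l r w"] assms by simp

lemma star_word_factors:
  assumes "l \<in> {1..q}" "r \<in> {1..q}" "set x \<subseteq> {1..q}" "set y \<subseteq> {1..q}"
  shows "(\<Sum>a\<in>{1..q}. star_word l r (x @ a # y)) = star_word l r x * Ps y"
proof (cases "l = r")
  case False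
  then show ?thesis by (rule star_word_factors_distinct) (use assms in auto)
next
  case True
  have "(\<Sum>a\<in>{1..q}. star_word l l (x @ a # y)) =
      (\<Sum>a\<in>{1..q}. Ps ((l # x) @ a # y)) - (\<Sum>r\<in>{1..q} - {l}. \<Sum>a\<in>{1..q}. star_word l r (x @ a # y))"
    using assms by (subst sum.swap) (simp add: star_word_equal sum_subtractf)
  also have "\<dots> = Ps (l # x) * Ps y - (\<Sum>r\<in>{1..q} - {l}. star_word l r x * Ps y)"
    using assms Ps_factors[of "l # x" y] star_word_factors_distinct[of l _ x y] by simp
  also have "\<dots> = star_word l l x * Ps y"
    using assms by (simp add: star_word_equal left_diff_distrib sum_distrib_right)
  finally show ?thesis using True by simp
qed

lemma star_word_commute: "star_word l r w = star_word r l w"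
proof (cases "l = r")
  case False
  then show ?thesis
  proof (induction w rule: length_induct)
    case (1 w)
    show ?case
    proof (cases "distinct_adj w \<and> w \<noteq> [] \<and> hd w \<notin> {l, r}")
      case True
      let ?R = "cc (real (length w) + 1) * dd (real (length w))"
      have "?R * star_word l r w = ?R * star_word r l w"
        using star_word_rec[of l r w] star_word_rec[of r l w] True 1 by simp
      moreover have "?R \<noteq> 0" using cc_pos[of "real (length w) + 1"] dd_pos[of "real (length w)"] True by simp
      ultimately show ?thesis by simp
    next
      case False
      then show ?thesis by (cases w) (auto simp: star_word_improper star_word_forbidden)
    qed
  qed
qed simp

lemma star_word_map_distinct:
  assumes "l \<noteq> r"
  shows "inj f \<Longrightarrow> star_word (f l) (f r) (map f w) = star_word l r w"
proof (induction w rule: length_induct)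
  case (1 w)
  have d: "distinct_adj (map f w) \<longleftrightarrow> distinct_adj w"
    using 1(2) by (metis distinct_adj_map_iff inj_on_subset subset_UNIV)
  show ?case
  proof (cases "distinct_adj w \<and> w \<noteq> [] \<and> hd w \<notin> {l, r}")
    case True
    let ?R = "cc (real (length w) + 1) * dd (real (length w))"
    have hd: "hd (map f w) \<notin> {f l, f r}" using True 1(2) by (auto simp: hd_map inj_eq)
    have "?R * star_word (f l) (f r) (map f w) =
        (\<Sum>i<length w. cc (2 * real i + 1) * star_word (f l) (f r) (map f (del (Suc i) w)))"
      using star_word_rec[of "f l" "f r" "map f w"] True d hd assms 1(2) by (simp add: map_del inj_eq)
    also have "\<dots> = ?R * star_word l r w"
      using star_word_rec[of l r w] assms True 1 by simp
    finally have "?R * star_word (f l) (f r) (map f w) = ?R * star_word l r w" .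
    moreover have "?R \<noteq> 0" using cc_pos[of "real (length w) + 1"] dd_pos[of "real (length w)"] True by simp
    ultimately show ?thesis by simp
  next
    case False
    then show ?thesis using d by (cases w) (auto simp: star_word_improper star_word_forbidden)
  qed
qed

lemma star_word_map:
  assumes \<sigma>: "\<sigma> permutes {1..q}" and "l \<in> {1..q}" "r \<in> {1..q}" "set w \<subseteq> {1..q}"
  shows "star_word (\<sigma> l) (\<sigma> r) (map \<sigma> w) = star_word l r w"
proof (cases "l = r")
  case False
  then show ?thesis using star_word_map_distinct permutes_inj[OF \<sigma>] by simp
next
  case True
  have in_iff: "\<sigma> c \<in> {1..q} \<longleftrightarrow> c \<in> {1..q}" for c using permutes_in_image[OF \<sigma>] .
  have "(\<Sum>r\<in>{1..q} - {\<sigma> l}. star_word (\<sigma> l) r (map \<sigma> w)) =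
      (\<Sum>r\<in>{1..q} - {l}. star_word (\<sigma> l) (\<sigma> r) (map \<sigma> w))"
  proof (rule sum.reindex_bij_betw[symmetric])
    have "\<sigma> ` ({1..q} - {l}) = {1..q} - {\<sigma> l}"
      using permutes_image[OF \<sigma>] permutes_inj[OF \<sigma>] by (simp add: image_set_diff)
    then show "bij_betw \<sigma> ({1..q} - {l}) ({1..q} - {\<sigma> l})"
      using permutes_inj[OF \<sigma>] by (metis bij_betw_imageI inj_on_subset subset_UNIV)
  qed
  also have "\<dots> = (\<Sum>r\<in>{1..q} - {l}. star_word l r w)"
    using star_word_map_distinct[OF _ permutes_inj[OF \<sigma>]] by (intro sum.cong) auto
  moreover have "Ps (\<sigma> l # map \<sigma> w) = Ps (l # w)"
    using Ps_map[of \<sigma> "l # w"] permutes_inj_on[OF \<sigma>] by (simp del: inj_on_insert)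
  moreover have "set (map \<sigma> w) \<subseteq> {1..q}" "\<sigma> l \<in> {1..q}" using assms(2,4) in_iff by auto
  ultimately show ?thesis using True assms by (simp add: star_word_equal)
qed

section \<open>Nonnegativity\<close>

lemma star_word_nonneg_distinct: "l \<noteq> r \<Longrightarrow> star_word l r w \<ge> 0"
proof (induction w rule: length_induct)
  case (1 w)
  show ?case
  proof (cases "distinct_adj w \<and> w \<noteq> [] \<and> hd w \<notin> {l, r}")
    case True
    let ?R = "cc (real (length w) + 1) * dd (real (length w))"
    have "?R * star_word l r w \<ge> 0"
      using True 1 by (subst star_word_rec) (auto intro!: sum_nonneg mult_nonneg_nonneg less_imp_le[OF cc_pos])
    moreover have "?R > 0" using cc_pos[of "real (length w) + 1"] dd_pos[of "real (length w)"] True by simp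
    ultimately show ?thesis by (simp add: zero_le_mult_iff)
  next
    case False
    then show ?thesis by (cases w) (auto simp: star_word_improper star_word_forbidden)
  qed
qed

text \<open>The recursion of the line for \<open>l # y\<close>, shifted to the weights of the star on the deletions in \<open>y\<close>
  and compared with the normalization of the star.\<close>

lemma Ps_Cons_deletion_sum:
  assumes "distinct_adj (l # y)"
  shows "(\<Sum>i<length y. cc (2 * real i + 1) * Ps (l # del (Suc i) y)) =
    (cc (real (length y) + 1) * dd (real (length y)) + real q * cc 1) * Ps (l # y) - cc 1 * Ps y"
proof -
  define N where "N = length y"
  define h where "h = 1 - real N"
  have *: "cc (real (length (l # y)) - 1 - 2 * real (Suc i) + h) = cc (2 * real i + 1)" for i
    using cc_minus[of "2 * real i + 1"] by (simp add: h_def N_def algebra_simps)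
  have h1: "cc h = cc (real N - 1)" using cc_minus[of h] by (simp add: h_def)
  have h2: "cc (real (length (l # y)) - 1 - 2 * real 0 + h) = cc 1" by (simp add: h_def N_def)
  have "cc 1 * Ps y + (\<Sum>i<N. cc (2 * real i + 1) * Ps (l # del (Suc i) y)) =
      cc (real N - 1) * dd (real N + 2) * Ps (l # y)"
    using Ps_shifted_sum[OF assms, of h]
    unfolding sum_del_Cons[of "\<lambda>j w. cc (real (length (l # y)) - 1 - 2 * real j + h) * Ps w"] * h1 h2
    by (simp add: N_def add_ac)
  moreover have "cc (real N - 1) * dd (real N + 2) = cc (real N + 1) * dd (real N) + real q * cc 1"
  proof -
    have 1: "real N - (real N + 1) = - 1" "real N + 2 - (real N - 1) = 3"
      "real N + (real N + 1) = real N + 2 + (real N - 1)" by simp_all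
    show ?thesis unfolding cc_dd 1 ss_3 using ss_1_pos by (simp add: field_simps)
  qed
  ultimately show ?thesis by (simp add: N_def)
qed

text \<open>The complement \<open>Ps (l # y) - star_word l l y\<close> is a sum of terms with different leaves, each of
  which satisfies the recursion of the star, except that the right leaf may not have the color of
  the center; this color accounts for the term with \<open>hd y\<close> as a leaf.\<close>

lemma equal_leaves_rec:
  assumes "l \<in> {1..q}" "set y \<subseteq> {1..q}" "distinct_adj (l # y)" "y \<noteq> []"
  shows "cc (real (length y) + 1) * dd (real (length y)) * star_word l l y =
    (\<Sum>i<length y. cc (2 * real i + 1) * star_word l l (del (Suc i) y)) +
    cc 1 * (star_word l (hd y) (tl y) + Ps y - real q * Ps (l # y))"
proof -
  obtain z v where y: "y = z # v" using assms(4) by (cases y) auto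
  define N where "N = length y"
  let ?R = "cc (real N + 1) * dd (real N)"
  have z: "z \<noteq> l" "z \<in> {1..q}" "distinct_adj y" using assms by (auto simp: y distinct_adj_Cons)
  have sub: "set (del (Suc i) y) \<subseteq> {1..q}" for i by (rule subset_trans[OF set_del_subset assms(2)])

  have other: "?R * star_word l r y = (\<Sum>i<N. cc (2 * real i + 1) * star_word l r (del (Suc i) y)) -
      (if r = z then cc 1 * star_word l z v else 0)" if "r \<in> {1..q} - {l}" for r
  proof (cases "r = z")
    case True
    have "(\<Sum>i<N. cc (2 * real i + 1) * star_word l r (del (Suc i) y)) = cc 1 * star_word l z v"
      unfolding N_def y sum_del_Cons[of "\<lambda>i w. cc (2 * real i + 1) * star_word l r w"]
      by (simp add: True star_word_forbidden)
    then show ?thesis using True by (simp add: y star_word_forbidden)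
  next
    case False
    then show ?thesis using star_word_rec[of l r y] that z by (simp add: N_def y)
  qed
  have "?R * (Ps (l # y) - star_word l l y) = (\<Sum>r\<in>{1..q} - {l}. ?R * star_word l r y)"
    using star_word_equal[OF assms(1,2)] by (simp add: sum_distrib_left)
  also have "\<dots> = (\<Sum>r\<in>{1..q} - {l}. \<Sum>i<N. cc (2 * real i + 1) * star_word l r (del (Suc i) y)) -
      (\<Sum>r\<in>{1..q} - {l}. if r = z then cc 1 * star_word l z v else 0)"
    using other by (simp add: sum_subtractf)
  also have "(\<Sum>r\<in>{1..q} - {l}. if r = z then cc 1 * star_word l z v else 0) = cc 1 * star_word l z v"
    using z by (simp add: sum.delta)
  also have "(\<Sum>r\<in>{1..q} - {l}. \<Sum>i<N. cc (2 * real i + 1) * star_word l r (del (Suc i) y)) =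
      (\<Sum>i<N. cc (2 * real i + 1) * (Ps (l # del (Suc i) y) - star_word l l (del (Suc i) y)))"
    by (subst sum.swap) (simp add: star_word_equal[OF assms(1) sub] sum_distrib_left)
  also have "\<dots> = (\<Sum>i<N. cc (2 * real i + 1) * Ps (l # del (Suc i) y)) -
      (\<Sum>i<N. cc (2 * real i + 1) * star_word l l (del (Suc i) y))"
    by (simp add: right_diff_distrib sum_subtractf)
  also have "(\<Sum>i<N. cc (2 * real i + 1) * Ps (l # del (Suc i) y)) =
      (?R + real q * cc 1) * Ps (l # y) - cc 1 * Ps y"
    unfolding N_def by (rule Ps_Cons_deletion_sum) (rule assms)
  finally show ?thesis by (simp add: y N_def algebra_simps)
qed

text \<open>The base case needs \<open>q \<ge> 5\<close>, while the factors at least double from one length to the next because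
  \<open>sinh\<close> grows by more than \<open>cosh (2 * t) + sinh (2 * t) \<ge> 2\<close>.\<close>

lemma star_normalization_growth:
  assumes "N \<ge> 3"
  shows "cc (real N + 1) * dd (real N) \<ge> real q ^ 2 * cc 1 * 2 ^ (N - 3)"
  using assms
proof (induction N rule: nat_induct_at_least)
  case base
  have "cc 4 = 2 * (cc 2)\<^sup>2 - 1"
    using cc_add[of 2 2] cc_sq[of 2] by (simp add: power2_eq_square)
  then have "cc 4 = ((2 * cc 2)\<^sup>2 - 2) / 2" by (simp add: power_mult_distrib)
  then have "cc 4 * dd 3 = cc 1 * ((real q - 1) * ((2 * cc 2)\<^sup>2 - 2))"
    by (simp only: dd_3) simp
  then have eq: "cc 4 * dd 3 = cc 1 * ((real q - 1) * ((real q - 2)\<^sup>2 - 2))" by (simp only: cc_2)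
  have "(real q - 1) * ((real q - 2)\<^sup>2 - 2) \<ge> (real q)\<^sup>2"
  proof -
    \<comment> \<open>Shifted to the smallest admissible \<open>q\<close>, the polynomial has nonnegative coefficients.\<close>
    define p where "p = real q - 5"
    have p: "p \<ge> 0" "real q = p + 5" using q5 by (auto simp: p_def)
    have "(real q - 1) * ((real q - 2)\<^sup>2 - 2) - (real q)\<^sup>2 = p ^ 3 + 9 * p ^ 2 + 21 * p + 3"
      by (simp add: p(2) algebra_simps power2_eq_square power3_eq_cube)
    also have "\<dots> \<ge> 0" using p(1) by simp
    finally show ?thesis by simp
  qed
  then show ?case using mult_left_mono[of _ _ "cc 1"] cc_pos[of 1] eq by (simp add: mult_ac)
next
  case (Suc N)
  have R: "cc (real n + 1) * dd (real n) = cc 1 / ss 1 * (ss (2 * real n + 1) - ss 1)" for n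
    unfolding cc_dd using ss_minus[of 1] by (simp add: algebra_simps del: ss_minus)
  have "ss 1 \<ge> 1 / 2"
  proof -
    have "(1 / 2 :: real)\<^sup>2 = 1 / 4" by (simp add: power2_eq_square)
    moreover have "real q \<ge> 5" using q5 by simp
    ultimately have "(1 / 2)\<^sup>2 \<le> (ss 1)\<^sup>2" using cc_sq[of 1] q_eq by linarith
    then show ?thesis by (rule power2_le_imp_le) (use ss_1_pos in simp)
  qed
  then have "ss 2 \<ge> 1" using ss_add[of 1 1] mult_mono[of "1/2" "ss 1" 1 "cc 1"] cc_ge_1[of 1] by (simp add: mult_ac)
  moreover have "cc 2 \<ge> 1" by (rule cc_ge_1)
  moreover have "cc r \<ge> ss r" for r
    by (simp add: cc_def ss_def cosh_def sinh_def)
  moreover have "ss (2 * real N + 1) \<ge> 0" by (rule ss_nonneg) simp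
  ultimately have "ss (2 * real N + 1) * cc 2 \<ge> ss (2 * real N + 1) * 1"
    "cc (2 * real N + 1) * ss 2 \<ge> ss (2 * real N + 1) * 1"
    by (intro mult_left_mono mult_mono; simp add: less_imp_le[OF cc_pos])+
  then have "ss (2 * real N + 1 + 2) \<ge> 2 * ss (2 * real N + 1)" unfolding ss_add[of _ 2] by linarith
  then have "ss (2 * real (Suc N) + 1) - ss 1 \<ge> 2 * (ss (2 * real N + 1) - ss 1)"
    using ss_1_pos by (simp add: add_ac)
  then have "cc (real (Suc N) + 1) * dd (real (Suc N)) \<ge> cc 1 / ss 1 * (2 * (ss (2 * real N + 1) - ss 1))"
    unfolding R[of "Suc N"] using cc_pos[of 1] ss_1_pos by (intro mult_left_mono) auto
  also have "cc 1 / ss 1 * (2 * (ss (2 * real N + 1) - ss 1)) = 2 * (cc (real N + 1) * dd (real N))"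
    unfolding R[of N] by simp
  finally have "2 * (cc (real N + 1) * dd (real N)) \<le> cc (real (Suc N) + 1) * dd (real (Suc N))" .
  moreover have "real q ^ 2 * cc 1 * 2 ^ (Suc N - 3) = 2 * (real q ^ 2 * cc 1 * 2 ^ (N - 3))"
    using Suc.hyps by (simp only: Suc_diff_le power_Suc mult_ac)
  ultimately show ?case using Suc.IH by linarith
qed

text \<open>If the bound holds with the factor \<open>f\<close> for the shorter words, then \<open>equal_leaves_rec\<close> gives it for
  \<open>y\<close> with \<open>f\<close> reduced by at most \<open>q * cosh t / (2 * R)\<close>, where \<open>R\<close> is the normalization; here the positive
  term \<open>Ps y\<close> compensates half of the negative one by \<open>Ps_Cons_le\<close>.  By the growth of \<open>R\<close> this loss is at
  most \<open>f / 2\<close>, so halving the factor at each step is affordable.  The truncated exponent is deliberate: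
  for words of length one and two the factor is exactly \<open>1 / q\<close>, and the estimate would fail if
  the halving started earlier.\<close>

lemma equal_leaves_lower_bound:
  assumes l: "l \<in> {1..q}"
  shows "set y \<subseteq> {1..q} \<Longrightarrow> y \<noteq> [] \<Longrightarrow> star_word l l y \<ge> Ps (l # y) / (real q * 2 ^ (length y - 2))"
proof (induction y rule: length_induct)
  case (1 y)
  obtain z v where y: "y = z # v" using 1 by (cases y) auto
  define N where "N = length y"
  show ?case
  proof (cases "distinct_adj (l # y)")
    case False
    then have "star_word l l y = 0" using star_word_improper[of y] star_word_forbidden[of z l l v] by (auto simp: y)
    then show ?thesis using False by (simp add: Ps_improper)
  next
    case proper: True
    have rec: "cc (real N + 1) * dd (real N) * star_word l l y =
        (\<Sum>i<N. cc (2 * real i + 1) * star_word l l (del (Suc i) y)) +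
        cc 1 * (star_word l z v + Ps y - real q * Ps (l # y))"
      using equal_leaves_rec[OF l 1(2) proper] by (simp add: N_def y)
    consider "N = 1" | "N = 2" | "N \<ge> 3" 
      using y by (cases "length v" rule: nat.exhaust) (auto simp: N_def Suc_le_eq numeral_eq_Suc)
    then show ?thesis
    proof cases
      assume "N = 1"
      then have "v = []" by (simp add: N_def y)
      then show ?thesis using proper q5 by (simp add: y star_word_single Ps_3 Ps_2 power2_eq_square mult_ac)
    next
      assume N: "N = 2"
      then obtain x where v: "v = [x]" by (cases v) (auto simp: N_def y)
      have ne: "l \<noteq> z" "z \<noteq> x" using proper by (auto simp: y v)
      define c where "c = cc 1"
      have c: "c > 0" by (simp add: c_def cc_pos)
      have "(real q - 3) * c * real q * star_word l l y =
          c * star_word l l [x] + (real q - 3) * c * star_word l l [z] +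
          c * (star_word l z [x] + Ps y - real q * Ps (l # y))"
        using rec by (simp add: N y v lessThan_Suc numeral_2_eq_2 cc_3 dd_2 c_def flip: numeral_3_eq_3)
      moreover
      \<comment> \<open>The values of \<open>P\<^sup>*\<close> at words of the forms \<open>aba\<close> and \<open>abc\<close>.\<close>
      define p s where "p = 1 / (real q ^ 2 * (real q - 1))" and "s = 1 / (real q ^ 2 * (real q - 2))"
      have "star_word l l [z] = p" "star_word l l [x] = (if l = x then 0 else p)"
        "star_word l z [x] = (if l = x then 0 else s)" "Ps (l # y) = (if l = x then p else s)"
        using ne by (auto simp: star_word_single Ps_3 y v p_def s_def Ps_improper)
      moreover have "Ps y = real q * p"
        using ne q5 by (simp add: Ps_2 y v p_def power2_eq_square)
      moreover have "real q * p - p = real q * s - 2 * s"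
      proof -
        have "(real q - 1) * p = 1 / real q ^ 2" "(real q - 2) * s = 1 / real q ^ 2"
          using q5 by (simp_all add: p_def s_def)
        then show ?thesis by (simp add: algebra_simps)
      qed
      then have "p + (real q - 3) * p + s + real q * p - real q * s = (real q - 3) * s"
        by (simp add: algebra_simps)
      then have "c * (p + (real q - 3) * p + s + real q * p - real q * s) = c * ((real q - 3) * s)"
        by (simp only:)
      ultimately have "c * ((real q - 3) * (real q * star_word l l y)) = c * ((real q - 3) * Ps (l # y))"
        by (cases "l = x") (simp_all add: algebra_simps)
      moreover have "c \<noteq> 0" "real q - 3 \<noteq> 0" using c q5 by auto
      ultimately have "real q * star_word l l y = Ps (l # y)" by (simp only: mult_cancel_left simp_thms)
      then show ?thesis using N q5 by (simp add: N_def field_simps)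
    next
      assume N: "N \<ge> 3"
      define f where "f = 1 / (real q * 2 ^ (N - 3))"
      define R where "R = cc (real N + 1) * dd (real N)"
      define w where "w = Ps (l # y)"
      have f: "f \<ge> 0" "f \<le> 1"
      proof -
        have "real q * 2 ^ (N - 3) \<ge> 1 * 1" using q5 by (intro mult_mono) auto
        then show "f \<ge> 0" "f \<le> 1" by (auto simp: f_def)
      qed
      have R: "R \<ge> real q ^ 2 * cc 1 * 2 ^ (N - 3)" "R > 0"
        using star_normalization_growth[OF N] cc_pos[of "real N + 1"] dd_pos[of "real N"] N by (auto simp: R_def)
      have IH: "star_word l l (del (Suc i) y) \<ge> f * Ps (l # del (Suc i) y)" if "i < N" for i
      proof -
        have len: "length (del (Suc i) y) = N - 1" using that by (simp add: N_def)
        then have "del (Suc i) y \<noteq> []" using N by auto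
        moreover have "length (del (Suc i) y) < length y" using that by (simp add: N_def)
        moreover have "set (del (Suc i) y) \<subseteq> {1..q}" by (rule subset_trans[OF set_del_subset 1(2)])
        ultimately have "star_word l l (del (Suc i) y) \<ge>
            Ps (l # del (Suc i) y) / (real q * 2 ^ (length (del (Suc i) y) - 2))"
          using 1(1) by blast
        then show ?thesis using N by (simp add: len f_def numeral_3_eq_3)
      qed
      have sumPs: "(\<Sum>i<N. cc (2 * real i + 1) * Ps (l # del (Suc i) y)) = (R + real q * cc 1) * w - cc 1 * Ps y"
        unfolding R_def w_def N_def by (rule Ps_Cons_deletion_sum[OF proper])
      have "R * star_word l l y \<ge> (\<Sum>i<N. cc (2 * real i + 1) * (f * Ps (l # del (Suc i) y))) +
          cc 1 * (0 + Ps y - real q * w)"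
        unfolding R_def rec w_def using IH star_word_nonneg_distinct[of l z v] proper y
        by (intro add_mono sum_mono mult_left_mono less_imp_le[OF cc_pos] diff_mono) auto
      also have "(\<Sum>i<N. cc (2 * real i + 1) * (f * Ps (l # del (Suc i) y))) = f * ((R + real q * cc 1) * w - cc 1 * Ps y)"
        unfolding sumPs[symmetric] by (simp add: sum_distrib_left mult_ac)
      also have "f * ((R + real q * cc 1) * w - cc 1 * Ps y) + cc 1 * (0 + Ps y - real q * w) =
          f * R * w + (1 - f) * cc 1 * (Ps y - real q * w)"
        by (simp add: algebra_simps)
      also have "\<dots> \<ge> f * R * w + (1 - f) * cc 1 * (- (real q / 2 * w))"
      proof -
        have "real q / 2 * w \<le> Ps y" using Ps_Cons_le[of l y] q5 by (simp add: w_def field_simps)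
        then have "- (real q / 2 * w) \<le> Ps y - real q * w" by (simp add: algebra_simps)
        then show ?thesis using f cc_pos[of 1] by (intro add_left_mono mult_left_mono) auto
      qed
      also have "f * R * w + (1 - f) * cc 1 * (- (real q / 2 * w)) \<ge> f * R * w - 1 * cc 1 * (real q / 2 * w)"
      proof -
        have "(1 - f) * (cc 1 * (real q / 2 * w)) \<le> 1 * (cc 1 * (real q / 2 * w))"
          using f Ps_nonneg cc_pos[of 1] by (intro mult_right_mono) (auto simp: w_def)
        then show ?thesis by (simp add: algebra_simps)
      qed
      also have "f * R * w - 1 * cc 1 * (real q / 2 * w) \<ge> f / 2 * R * w"
      proof -
        have "f * (real q ^ 2 * cc 1 * 2 ^ (N - 3)) \<le> f * R" using R f by (intro mult_left_mono)
        then have "real q * cc 1 \<le> f * R" using q5 by (simp add: f_def power2_eq_square)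
        then have "real q * cc 1 * w \<le> f * R * w" using Ps_nonneg by (intro mult_right_mono) (auto simp: w_def)
        then show ?thesis by (simp add: algebra_simps)
      qed
      finally have "R * (f / 2 * w) \<le> R * star_word l l y" by (simp add: mult_ac)
      then have "f / 2 * w \<le> star_word l l y" using R(2) by simp
      moreover have "f / 2 = 1 / (real q * 2 ^ (N - 2))"
      proof -
        have "N - 2 = Suc (N - 3)" using N by simp
        then show ?thesis by (simp add: f_def)
      qed
      ultimately show ?thesis by (simp add: w_def N_def)
    qed
  qed
qed

lemma star_word_nonneg:
  assumes "l \<in> {1..q}" "set w \<subseteq> {1..q}"
  shows "star_word l r w \<ge> 0"
proof (cases "l = r \<and> w \<noteq> []")
  case True
  have "0 \<le> Ps (l # w) / (real q * 2 ^ (length w - 2))" using Ps_nonneg by simp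
  also have "\<dots> \<le> star_word l l w" using equal_leaves_lower_bound[OF assms] True by simp
  finally show ?thesis using True by simp
next
  case False
  then show ?thesis using star_word_nonneg_distinct by (cases "w = []") auto
qed

end

section \<open>A random sequence with prescribed prefix probabilities\<close>

text \<open>Independently for every finite history, draw a letter from the conditional distribution of
  the next letter given that history.  Following the drawn letters from the empty history yields the
  sequence; its first letters are \<open>xs\<close> iff the letter drawn at each proper prefix of \<open>xs\<close> is the
  next letter of \<open>xs\<close>, and these draws are independent.  A letter outside \<open>S\<close> is drawn with
  probability zero; it is replaced by the arbitrary letter \<open>s0\<close> so that the sequence takes its values in
  \<open>S\<close> everywhere and not only almost surely.\<close>

context
  fixes S :: "nat set" and s0 :: nat
begin

definition clip :: "nat \<Rightarrow> nat" where "clip a = (if a \<in> S then a else s0)"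

primrec history :: "nat \<Rightarrow> (nat list \<Rightarrow> nat) \<Rightarrow> nat list" where
  "history 0 \<omega> = []"
| "history (Suc n) \<omega> = history n \<omega> @ [clip (\<omega> (history n \<omega>))]"

lemma history_eq_iff:
  "history (length xs) \<omega> = xs \<longleftrightarrow> (\<forall>i<length xs. clip (\<omega> (take i xs)) = xs ! i)"
proof (induction xs rule: rev_induct)
  case (snoc a xs)
  then show ?case by (auto simp: less_Suc_eq nth_append)
qed simp

lemma length_history [simp]: "length (history n \<omega>) = n"
  by (induction n) auto

lemma history_nth: "i < n \<Longrightarrow> history n \<omega> ! i = clip (\<omega> (history i \<omega>))"
  by (induction n) (auto simp: nth_append less_Suc_eq)

end

lemma random_sequence_exists:
  fixes p :: "nat list \<Rightarrow> real"
  assumes S: "finite S" "S \<noteq> {}" and p1: "p [] = 1"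
    and nonneg: "\<And>xs. set xs \<subseteq> S \<Longrightarrow> p xs \<ge> 0"
    and consistent: "\<And>xs. set xs \<subseteq> S \<Longrightarrow> (\<Sum>a\<in>S. p (xs @ [a])) = p xs"
  obtains M :: "(nat list \<Rightarrow> nat) measure" and Z where "prob_space M"
    "\<And>n. Z n \<in> M \<rightarrow>\<^sub>M count_space S"
    "\<And>xs. set xs \<subseteq> S \<Longrightarrow> measure M {\<omega> \<in> space M. \<forall>i<length xs. Z i \<omega> = xs ! i} = p xs"
proof -
  obtain s0 where s0: "s0 \<in> S" using S by auto
  \<comment> \<open>A history of probability zero has only continuations of probability zero, so any
    distribution will do.\<close>
  have next_letter: "\<exists>K. set_pmf K \<subseteq> S \<and> (\<forall>a\<in>S. p h * pmf K a = p (h @ [a]))" if h: "set h \<subseteq> S" for h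
  proof (cases "p h = 0")
    case True
    have "p (h @ [a]) = 0" if "a \<in> S" for a
      using consistent[OF h] S(1) nonneg[of "h @ [_]"] h that
      by (subst (asm) True) (auto simp: sum_nonneg_eq_0_iff)
    then show ?thesis using True s0 by (intro exI[of _ "return_pmf s0"]) auto
  next
    case False
    define f where "f a = (if a \<in> S then p (h @ [a]) / p h else 0)" for a
    have f0: "f a \<ge> 0" for a using nonneg[of "h @ [a]"] nonneg[OF h] h by (auto simp: f_def)
    have "(\<integral>\<^sup>+a. ennreal (f a) \<partial>count_space UNIV) = (\<Sum>a\<in>S. ennreal (f a))"
      using S(1) by (intro nn_integral_count_space') (auto simp: f_def)
    also have "\<dots> = ennreal (\<Sum>a\<in>S. f a)" using f0 by (simp add: sum_ennreal)
    also have "(\<Sum>a\<in>S. f a) = 1"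
      using consistent[OF h] False by (simp add: f_def flip: sum_divide_distrib)
    finally have "(\<integral>\<^sup>+a. ennreal (f a) \<partial>count_space UNIV) = 1" by simp
    then have pmf: "pmf (embed_pmf f) a = f a" for a using f0 by (intro pmf_embed_pmf)
    then have "set_pmf (embed_pmf f) \<subseteq> S" by (auto simp: set_pmf_eq f_def split: if_splits)
    then show ?thesis using pmf False by (intro exI[of _ "embed_pmf f"]) (auto simp: f_def)
  qed
  then obtain K where K: "\<And>h. set h \<subseteq> S \<Longrightarrow> set_pmf (K h) \<subseteq> S"
    "\<And>h a. set h \<subseteq> S \<Longrightarrow> a \<in> S \<Longrightarrow> p h * pmf (K h) a = p (h @ [a])"
    by metis

  define M where "M = (\<Pi>\<^sub>M h\<in>(UNIV :: nat list set). measure_pmf (K h))"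
  define hist where "hist = history S s0"
  define cl where "cl = clip S s0"
  define Z where "Z n \<omega> = cl (\<omega> (hist n \<omega>))" for n \<omega>
  interpret product_prob_space "\<lambda>h. measure_pmf (K h)" "UNIV :: nat list set"
    by unfold_locales
  have M: "prob_space M" unfolding M_def by (rule P.prob_space_axioms)
  have spaceM: "space M = UNIV" by (simp add: M_def space_PiM)

  have cl_meas: "(\<lambda>\<omega>. cl (\<omega> h)) \<in> M \<rightarrow>\<^sub>M count_space S" for h
  proof -
    have "(\<lambda>\<omega>. \<omega> h) \<in> M \<rightarrow>\<^sub>M measure_pmf (K h)"
      unfolding M_def by (rule measurable_component_singleton) simp
    moreover have "cl \<in> measure_pmf (K h) \<rightarrow>\<^sub>M count_space S"
      using s0 by (auto simp: cl_def clip_def)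
    ultimately show ?thesis by (rule measurable_compose)
  qed
  have step: "(\<lambda>\<omega>. F (hist n \<omega>) \<omega>) \<in> M \<rightarrow>\<^sub>M N" if "hist n \<in> M \<rightarrow>\<^sub>M count_space UNIV"
    "\<And>h. F h \<in> M \<rightarrow>\<^sub>M N" for n F N
    using that by (rule measurable_compose_countable[of F, rotated])
  have hist_meas: "hist n \<in> M \<rightarrow>\<^sub>M count_space UNIV" for n
  proof (induction n)
    case 0
    have "hist 0 = (\<lambda>_. [])" by (simp add: hist_def fun_eq_iff)
    then show ?case by simp
  next
    case (Suc n)
    have "(\<lambda>\<omega>. h @ [cl (\<omega> h)]) \<in> M \<rightarrow>\<^sub>M count_space UNIV" for h
      by (rule measurable_compose[OF cl_meas[of h]]) simp
    from step[OF Suc this] show ?case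
      by (simp add: hist_def cl_def cong: measurable_cong)
  qed
  have Z_meas: "Z n \<in> M \<rightarrow>\<^sub>M count_space S" for n
    using step[OF hist_meas cl_meas] by (simp add: Z_def[abs_def])

  have law: "measure M {\<omega> \<in> space M. \<forall>i<length xs. Z i \<omega> = xs ! i} = p xs" if xs: "set xs \<subseteq> S" for xs
  proof -
    have "(\<forall>i<length xs. Z i \<omega> = xs ! i) \<longleftrightarrow> hist (length xs) \<omega> = xs" for \<omega>
      by (auto simp: Z_def list_eq_iff_nth_eq hist_def cl_def history_nth)
    also have "\<And>\<omega>. (hist (length xs) \<omega> = xs) \<longleftrightarrow> (\<forall>i<length xs. cl (\<omega> (take i xs)) = xs ! i)"
      unfolding hist_def cl_def by (rule history_eq_iff)
    finally have ev: "{\<omega> \<in> space M. \<forall>i<length xs. Z i \<omega> = xs ! i} =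
        {\<omega> \<in> space M. \<forall>h\<in>(\<lambda>i. take i xs) ` {..<length xs}. \<omega> h \<in> {a. cl a = xs ! length h}}"
      by auto
    have inj: "inj_on (\<lambda>i. take i xs) {..<length xs}"
      by (rule inj_onI) (metis length_take lessThan_iff min.absorb4)
    have letter: "measure (measure_pmf (K h)) {a. cl a = b} = pmf (K h) b" if "set h \<subseteq> S" "b \<in> S" for h b
    proof -
      have "{a. cl a = b} \<inter> set_pmf (K h) = {b} \<inter> set_pmf (K h)"
        using K(1)[OF that(1)] that(2) by (auto simp: cl_def clip_def)
      then have "measure (measure_pmf (K h)) {a. cl a = b} = measure (measure_pmf (K h)) {b}"
        by (metis measure_Int_set_pmf)
      then show ?thesis by (simp add: pmf.rep_eq)
    qed
    have "emeasure M {\<omega> \<in> space M. \<forall>i<length xs. Z i \<omega> = xs ! i} =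
        (\<Prod>h\<in>(\<lambda>i. take i xs) ` {..<length xs}. emeasure (measure_pmf (K h)) {a. cl a = xs ! length h})"
      unfolding ev unfolding M_def by (rule emeasure_PiM_Collect) auto
    also have "\<dots> = (\<Prod>i<length xs. emeasure (measure_pmf (K (take i xs))) {a. cl a = xs ! i})"
      by (subst prod.reindex[OF inj]) (simp add: min_absorb2)
    also have "\<dots> = (\<Prod>i<length xs. ennreal (pmf (K (take i xs)) (xs ! i)))"
    proof (rule prod.cong)
      fix i assume "i \<in> {..<length xs}"
      then have "set (take i xs) \<subseteq> S" "xs ! i \<in> S"
        using xs by (auto dest: in_set_takeD)
      then show "emeasure (measure_pmf (K (take i xs))) {a. cl a = xs ! i} = ennreal (pmf (K (take i xs)) (xs ! i))"
        by (simp add: measure_pmf.emeasure_eq_measure letter)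
    qed simp
    also have "\<dots> = ennreal (\<Prod>i<length xs. pmf (K (take i xs)) (xs ! i))"
      by (rule prod_ennreal) simp
    finally have "measure M {\<omega> \<in> space M. \<forall>i<length xs. Z i \<omega> = xs ! i} =
        (\<Prod>i<length xs. pmf (K (take i xs)) (xs ! i))"
      by (simp add: measure_def prod_nonneg)
    also have "\<dots> = p xs" using xs
    proof (induction xs rule: rev_induct)
      case (snoc a xs)
      have "(\<Prod>i<length xs. pmf (K (take i (xs @ [a]))) ((xs @ [a]) ! i)) =
          (\<Prod>i<length xs. pmf (K (take i xs)) (xs ! i))"
        by (rule prod.cong) (auto simp: nth_append)
      then show ?case using snoc K(2)[of xs a] by simp
    qed (simp add: p1)
    finally show ?thesis .
  qed
  show thesis using that[of M Z] M Z_meas law by blast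
qed

section \<open>Laws and independence of finite-valued processes\<close>

text \<open>A function of one set per coordinate that is additive in each of them is determined by its values
  at singletons.  Statements about single colorings are passed on in this way to the
  product sets that generate the \<open>\<sigma>\<close>-algebra.\<close>

lemma box_functionals_agree:
  fixes \<Phi> \<Psi> :: "('v \<Rightarrow> 'c set) \<Rightarrow> real"
  assumes "finite J"
    and "\<And>E v. v \<in> J \<Longrightarrow> \<Phi> E = (\<Sum>a\<in>E v \<inter> S. \<Phi> (E(v := {a})))"
    and "\<And>E v. v \<in> J \<Longrightarrow> \<Psi> E = (\<Sum>a\<in>E v \<inter> S. \<Psi> (E(v := {a})))"
    and "\<And>E. (\<And>v. v \<in> J \<Longrightarrow> \<exists>a\<in>S. E v = {a}) \<Longrightarrow> \<Phi> E = \<Psi> E"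
  shows "\<Phi> E = \<Psi> E"
  using assms
proof (induction J arbitrary: \<Phi> \<Psi> E)
  case empty
  then show ?case by simp
next
  case (insert v J)
  have "\<Phi> (E(v := {a})) = \<Psi> (E(v := {a}))" if a: "a \<in> S" for a
  proof (rule insert.IH[of "\<lambda>E. \<Phi> (E(v := {a}))" "\<lambda>E. \<Psi> (E(v := {a}))"])
    fix E u assume u: "u \<in> J"
    then have uv: "u \<noteq> v" using insert.hyps by auto
    show "\<Phi> (E(v := {a})) = (\<Sum>b\<in>E u \<inter> S. \<Phi> (E(u := {b}, v := {a})))"
      using insert.prems(1)[of u "E(v := {a})"] u uv by (simp only: fun_upd_twist[OF uv] fun_upd_other[OF uv] insertI2)
    show "\<Psi> (E(v := {a})) = (\<Sum>b\<in>E u \<inter> S. \<Psi> (E(u := {b}, v := {a})))"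
      using insert.prems(2)[of u "E(v := {a})"] u uv by (simp only: fun_upd_twist[OF uv] fun_upd_other[OF uv] insertI2)
  next
    fix E :: "'v \<Rightarrow> 'c set" assume "\<And>u. u \<in> J \<Longrightarrow> \<exists>b\<in>S. E u = {b}"
    then show "\<Phi> (E(v := {a})) = \<Psi> (E(v := {a}))"
      using a by (intro insert.prems(3)) auto
  qed
  then have "(\<Sum>a\<in>E v \<inter> S. \<Phi> (E(v := {a}))) = (\<Sum>a\<in>E v \<inter> S. \<Psi> (E(v := {a})))"
    by (intro sum.cong) auto
  then show ?case
    using insert.prems(1)[OF insertI1, of E] insert.prems(2)[OF insertI1, of E] by (simp only:)
qed

locale finite_valued_process = prob_space M for M :: "'a measure" +
  fixes S :: "'c set" and Z :: "'v \<Rightarrow> 'a \<Rightarrow> 'c"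
  assumes finite_S: "finite S" and Z_measurable: "\<And>v. Z v \<in> M \<rightarrow>\<^sub>M count_space S"
begin

definition box :: "'v set \<Rightarrow> ('v \<Rightarrow> 'c set) \<Rightarrow> real" where
  "box J E = prob {\<omega> \<in> space M. \<forall>j\<in>J. Z j \<omega> \<in> E j}"

definition cyl :: "'v set \<Rightarrow> ('v \<Rightarrow> 'c) \<Rightarrow> real" where
  "cyl J c = box J (\<lambda>j. {c j})"

lemma Z_in_S: "\<omega> \<in> space M \<Longrightarrow> Z v \<omega> \<in> S"
  using measurable_space[OF Z_measurable, of \<omega> v] by simp

lemma Z_events: "{\<omega> \<in> space M. Z v \<omega> \<in> A} \<in> events"
proof -
  have "{\<omega> \<in> space M. Z v \<omega> \<in> A} = Z v -` (A \<inter> S) \<inter> space M" using Z_in_S by auto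
  then show ?thesis using measurable_sets[OF Z_measurable, of "A \<inter> S" v] by simp
qed

lemma box_events: "finite J \<Longrightarrow> {\<omega> \<in> space M. \<forall>j\<in>J. Z j \<omega> \<in> E j} \<in> events"
  by (rule sets.sets_Collect_finite_All) (use Z_events in auto)

lemma box_empty [simp]: "box {} E = 1"
  by (simp add: box_def prob_space)

lemma box_cong: "(\<And>j. j \<in> J \<Longrightarrow> E j = F j) \<Longrightarrow> box J E = box J F"
  by (simp add: box_def)

lemma cyl_cong: "(\<And>j. j \<in> J \<Longrightarrow> c j = d j) \<Longrightarrow> cyl J c = cyl J d"
  unfolding cyl_def by (rule box_cong) simp

lemma box_split:
  assumes J: "finite J" and v: "v \<in> J"
  shows "box J E = (\<Sum>a\<in>E v \<inter> S. box J (E(v := {a})))"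
proof -
  let ?B = "\<lambda>a. {\<omega> \<in> space M. \<forall>j\<in>J. Z j \<omega> \<in> (E(v := {a})) j}"
  have "{\<omega> \<in> space M. \<forall>j\<in>J. Z j \<omega> \<in> E j} = (\<Union>a\<in>E v \<inter> S. ?B a)"
    using v Z_in_S by (auto split: if_splits)
  moreover have "disjoint_family_on ?B (E v \<inter> S)"
    using v by (force simp: disjoint_family_on_def)
  ultimately show ?thesis unfolding box_def
    using finite_S box_events[OF J] by (simp only:) (intro finite_measure_finite_Union; blast)
qed

lemma box_superset:
  assumes "J \<subseteq> K"
  shows "box J E = box K (\<lambda>v. if v \<in> J then E v else UNIV)"
proof -
  have "{\<omega> \<in> space M. \<forall>j\<in>J. Z j \<omega> \<in> E j} =
      {\<omega> \<in> space M. \<forall>j\<in>K. Z j \<omega> \<in> (if j \<in> J then E j else UNIV)}"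
    using assms by auto
  then show ?thesis by (simp only: box_def)
qed

lemma cyl_marginal:
  assumes "finite J" "v \<notin> J"
  shows "cyl J c = (\<Sum>a\<in>S. cyl (insert v J) (c(v := a)))"
proof -
  have "cyl J c = box (insert v J) (\<lambda>u. if u \<in> J then {c u} else UNIV)"
    unfolding cyl_def by (rule box_superset) auto
  also have "\<dots> = (\<Sum>a\<in>S. box (insert v J) ((\<lambda>u. if u \<in> J then {c u} else UNIV)(v := {a})))"
    using assms by (subst box_split[of _ v]) auto
  also have "\<dots> = (\<Sum>a\<in>S. cyl (insert v J) (c(v := a)))"
    unfolding cyl_def by (intro sum.cong refl box_cong) (use assms(2) in auto)
  finally show ?thesis .
qed

lemma box_factors_if_cyl_factors:
  assumes JK: "finite J" "finite K" "J \<inter> K = {}"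
    and single: "\<And>c. (\<And>v. v \<in> J \<union> K \<Longrightarrow> c v \<in> S) \<Longrightarrow> cyl (J \<union> K) c = cyl J c * cyl K c"
  shows "box (J \<union> K) E = box J E * box K E"
proof (rule box_functionals_agree[of "J \<union> K" "box (J \<union> K)" S "\<lambda>E. box J E * box K E"])
  show "finite (J \<union> K)" using JK by simp
next
  fix E v assume "v \<in> J \<union> K"
  then show "box (J \<union> K) E = (\<Sum>a\<in>E v \<inter> S. box (J \<union> K) (E(v := {a})))"
    using JK by (intro box_split) auto
next
  fix E v assume v: "v \<in> J \<union> K"
  have other: "box L (E(v := {a})) = box L E" if "v \<notin> L" for L a
    using that by (intro box_cong) auto
  show "box J E * box K E = (\<Sum>a\<in>E v \<inter> S. box J (E(v := {a})) * box K (E(v := {a})))"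
  proof (cases "v \<in> J")
    case True
    then have "v \<notin> K" using JK by auto
    then show ?thesis using box_split[OF JK(1) True, of E] by (simp add: other sum_distrib_right)
  next
    case False
    then have "v \<in> K" using v by auto
    then show ?thesis using box_split[OF JK(2), of v E] False by (simp add: other sum_distrib_left)
  qed
next
  fix E :: "'v \<Rightarrow> 'c set" assume E: "\<And>v. v \<in> J \<union> K \<Longrightarrow> \<exists>a\<in>S. E v = {a}"
  then obtain c where c: "\<And>v. v \<in> J \<union> K \<Longrightarrow> c v \<in> S \<and> E v = {c v}" by metis
  have "box L E = cyl L c" if "L \<subseteq> J \<union> K" for L
    unfolding cyl_def using that c by (intro box_cong) auto
  then show "box (J \<union> K) E = box J E * box K E" using single[of c] c by simp
qed

text \<open>Being determined by boxes, independence only has to be checked on them.\<close>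

lemma indep_var_if_box_factors:
  assumes "\<And>J K E. finite J \<Longrightarrow> finite K \<Longrightarrow> J \<subseteq> A \<Longrightarrow> K \<subseteq> B \<Longrightarrow> box (J \<union> K) E = box J E * box K E"
    and AB: "A \<inter> B = {}"
  shows "indep_var (\<Pi>\<^sub>M v\<in>A. count_space S) (\<lambda>\<omega>. \<lambda>v\<in>A. Z v \<omega>) (\<Pi>\<^sub>M v\<in>B. count_space S) (\<lambda>\<omega>. \<lambda>v\<in>B. Z v \<omega>)"
proof -
  let ?X = "\<lambda>A \<omega>. \<lambda>v\<in>A. Z v \<omega>"
  let ?P = "\<lambda>A. \<Pi>\<^sub>M v\<in>A. count_space S"
  let ?G = "\<lambda>A. {?X A -` T \<inter> space M | T. T \<in> prod_algebra A (\<lambda>_. count_space S)}"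
  have rv: "?X A \<in> M \<rightarrow>\<^sub>M ?P A" for A
    by (rule measurable_restrict) (rule Z_measurable)
  have G: "sigma_sets (space M) {?X A -` T \<inter> space M | T. T \<in> sets (?P A)} = sigma_sets (space M) (?G A)" for A
  proof -
    have "{?X A -` T \<inter> space M | T. T \<in> sets (?P A)} = sigma_sets (space M) (?G A)"
      unfolding sets_PiM by (rule sigma_sets_vimage_commute) (use Z_in_S in auto)
    then show ?thesis by (simp only:) (intro sigma_sets_sigma_sets_eq; blast)
  qed
  have G_box: "\<exists>J E. finite J \<and> J \<subseteq> A \<and> g = {\<omega> \<in> space M. \<forall>j\<in>J. Z j \<omega> \<in> E j}" if g_in: "g \<in> ?G A" for g A
  proof -
    obtain T where T: "T \<in> prod_algebra A (\<lambda>_. count_space S)" and g: "g = ?X A -` T \<inter> space M"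
      using g_in by blast
    from T obtain J E where J: "finite J" "J \<subseteq> A" and T: "T = prod_emb A (\<lambda>_. count_space S) J (\<Pi>\<^sub>E j\<in>J. E j)"
      by (rule prod_algebraE) blast
    have "g = {\<omega> \<in> space M. \<forall>j\<in>J. Z j \<omega> \<in> E j}"
      unfolding g T prod_emb_def using J(2) Z_in_S
      by (auto simp: PiE_iff extensional_def restrict_def subset_eq)
    then show ?thesis using J by blast
  qed
  have Int_G: "Int_stable (?G A)" for A
  proof (rule Int_stableI)
    fix a b assume "a \<in> ?G A" "b \<in> ?G A"
    then obtain T U where TU: "T \<in> prod_algebra A (\<lambda>_. count_space S)" "U \<in> prod_algebra A (\<lambda>_. count_space S)"
      and ab: "a = ?X A -` T \<inter> space M" "b = ?X A -` U \<inter> space M" by blast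
    have "T \<inter> U \<in> prod_algebra A (\<lambda>_. count_space S)"
      using Int_stable_prod_algebra TU by (rule Int_stableD)
    moreover have "a \<inter> b = ?X A -` (T \<inter> U) \<inter> space M" using ab by auto
    ultimately show "a \<inter> b \<in> ?G A" by blast
  qed
  have G_events: "?G A \<subseteq> events" for A
  proof
    fix g assume g: "g \<in> ?G A"
    show "g \<in> events" using G_box[OF g] box_events by (elim exE conjE) (simp only:)
  qed
  have "indep_set (?G A) (?G B)"
  proof (rule indep_setI)
    show "?G A \<subseteq> events" "?G B \<subseteq> events" by (rule G_events)+
  next
    fix a b assume a: "a \<in> ?G A" and b: "b \<in> ?G B"
    obtain J E where J: "finite J" "J \<subseteq> A" "a = {\<omega> \<in> space M. \<forall>j\<in>J. Z j \<omega> \<in> E j}"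
      using G_box[OF a] by blast
    obtain K F where K: "finite K" "K \<subseteq> B" "b = {\<omega> \<in> space M. \<forall>j\<in>K. Z j \<omega> \<in> F j}"
      using G_box[OF b] by blast
    define H where "H v = (if v \<in> A then E v else F v)" for v
    have "v \<notin> A" if "v \<in> K" for v using that K(2) AB by auto
    then have ab: "a = {\<omega> \<in> space M. \<forall>j\<in>J. Z j \<omega> \<in> H j}" "b = {\<omega> \<in> space M. \<forall>j\<in>K. Z j \<omega> \<in> H j}"
      using J K by (auto simp: H_def)
    have "prob a = box J H" "prob b = box K H" by (simp_all add: box_def ab)
    moreover have "a \<inter> b = {\<omega> \<in> space M. \<forall>j\<in>J \<union> K. Z j \<omega> \<in> H j}" unfolding ab by auto
    then have "prob (a \<inter> b) = box (J \<union> K) H" by (simp add: box_def)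
    ultimately show "prob (a \<inter> b) = prob a * prob b" using assms(1) J K by simp
  qed
  then have "indep_set (sigma_sets (space M) (?G A)) (sigma_sets (space M) (?G B))"
    by (rule indep_set_sigma_sets) (rule Int_G)+
  then show ?thesis unfolding indep_var_eq G using rv by simp
qed

end

section \<open>The colored star as a random sequence\<close>

context five_colors
begin

definition star_law :: "nat list \<Rightarrow> real" where
  "star_law xs = (case xs of [] \<Rightarrow> 1 | l # ys \<Rightarrow> (case ys of [] \<Rightarrow> 1 / real q | r # w \<Rightarrow> star_word l r w))"

lemma star_law_simps [simp]:
  "star_law [] = 1" "star_law [l] = 1 / real q" "star_law (l # r # w) = star_word l r w"
  by (simp_all add: star_law_def)

lemma star_law_nonneg: "set xs \<subseteq> {1..q} \<Longrightarrow> star_law xs \<ge> 0"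
  by (cases xs rule: remdups_adj.cases) (auto simp: star_word_nonneg)

lemma star_law_consistent:
  assumes "set xs \<subseteq> {1..q}"
  shows "(\<Sum>a\<in>{1..q}. star_law (xs @ [a])) = star_law xs"
proof (cases xs rule: remdups_adj.cases)
  case (3 l r w)
  then show ?thesis using star_word_factors[of l r w "[]"] assms by simp
qed (use q5 in \<open>simp_all add: power2_eq_square\<close>)

lemma star_law_map:
  assumes "\<sigma> permutes {1..q}" "set xs \<subseteq> {1..q}"
  shows "star_law (map \<sigma> xs) = star_law xs"
  using assms by (cases xs rule: remdups_adj.cases) (simp_all add: star_word_map)

end

text \<open>Positions \<open>0\<close> and \<open>1\<close> of the sequence are the two leaves, position \<open>2\<close> is the center, and
  the long arm follows.  By the truncated subtraction the two leaves share the level \<open>0\<close>, and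
  two vertices are adjacent iff their levels differ by \<open>1\<close>.\<close>

definition level :: "nat \<Rightarrow> nat" where "level i = i - 1"

definition near :: "nat \<Rightarrow> nat \<Rightarrow> bool" where
  "near i j \<longleftrightarrow> level i = level j + 1 \<or> level j = level i + 1"

lemma near_commute: "near i j \<longleftrightarrow> near j i"
  by (auto simp: near_def)

locale star_process = five_colors q + finite_valued_process M "{1..q}" Z
  for q and M :: "'a measure" and Z :: "nat \<Rightarrow> 'a \<Rightarrow> nat" +
  assumes law: "set xs \<subseteq> {1..q} \<Longrightarrow> prob {\<omega> \<in> space M. \<forall>i<length xs. Z i \<omega> = xs ! i} = star_law xs"
begin

lemma cyl_prefix:
  assumes "\<And>i. i < n \<Longrightarrow> c i \<in> {1..q}"
  shows "cyl {..<n} c = star_law (map c [0..<n])"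
proof -
  have "cyl {..<n} c = prob {\<omega> \<in> space M. \<forall>i<length (map c [0..<n]). Z i \<omega> = map c [0..<n] ! i}"
    by (simp add: cyl_def box_def lessThan_def)
  also have "\<dots> = star_law (map c [0..<n])" using assms by (intro law) auto
  finally show ?thesis .
qed

lemma cyl_star:
  assumes "\<And>i. i < n \<Longrightarrow> c i \<in> {1..q}" "n \<ge> 2"
  shows "cyl {..<n} c = star_word (c 0) (c 1) (map c [2..<n])"
proof -
  have "[0..<n] = 0 # 1 # [2..<n]" using assms(2) by (simp add: upt_conv_Cons numeral_2_eq_2)
  then show ?thesis using cyl_prefix[OF assms(1)] by simp
qed

lemma cyl_left_line:
  assumes "\<And>i. i < n \<Longrightarrow> c i \<in> {1..q}" "n \<ge> 2"
  shows "cyl (insert 0 {2..<n}) c = Ps (c 0 # map c [2..<n])"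
proof -
  have "insert 1 (insert 0 {2..<n}) = {..<n}" using assms(2) by auto
  then have "cyl (insert 0 {2..<n}) c = (\<Sum>a\<in>{1..q}. cyl {..<n} (c(1 := a)))"
    by (subst cyl_marginal[of _ 1]) auto
  also have "\<dots> = (\<Sum>a\<in>{1..q}. star_word (c 0) a (map c [2..<n]))"
    using assms by (intro sum.cong refl) (subst cyl_star, auto simp: map_fun_upd)
  also have "\<dots> = Ps (c 0 # map c [2..<n])"
    using assms by (intro star_word_sum_right) auto
  finally show ?thesis .
qed

lemma cyl_right_line:
  assumes "\<And>i. i < n \<Longrightarrow> c i \<in> {1..q}" "n \<ge> 2"
  shows "cyl {1..<n} c = Ps (map c [1..<n])"
proof -
  have "insert 0 {1..<n} = {..<n}" using assms(2) by auto
  then have "cyl {1..<n} c = (\<Sum>a\<in>{1..q}. cyl {..<n} (c(0 := a)))"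
    by (subst cyl_marginal[of _ 0]) auto
  also have "\<dots> = (\<Sum>a\<in>{1..q}. star_word (c 1) a (map c [2..<n]))"
    using assms
    by (intro sum.cong refl) (subst cyl_star, auto simp: map_fun_upd star_word_commute)
  also have "\<dots> = Ps (c 1 # map c [2..<n])"
    using assms by (intro star_word_sum_right) auto
  also have "c 1 # map c [2..<n] = map c [1..<n]"
    using upt_conv_Cons[of 1 n] assms(2) by (simp add: numeral_2_eq_2)
  finally show ?thesis .
qed

text \<open>Position \<open>1\<close>, the right leaf, is followed by the center, so an interval of positions that avoids the left
  leaf is a path.\<close>

lemma cyl_interval:
  assumes "n \<ge> 2"
  shows "m \<ge> 1 \<Longrightarrow> (\<And>i. i < n \<Longrightarrow> c i \<in> {1..q}) \<Longrightarrow> cyl {m..<n} c = Ps (map c [m..<n])"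
proof (induction m arbitrary: c rule: nat_induct_at_least)
  case base
  then show ?case using assms by (intro cyl_right_line)
next
  case (Suc m)
  show ?case
  proof (cases "m < n")
    case True
    have "insert m {Suc m..<n} = {m..<n}" using True by auto
    then have "cyl {Suc m..<n} c = (\<Sum>a\<in>{1..q}. cyl {m..<n} (c(m := a)))"
      by (subst cyl_marginal[of _ m]) auto
    also have "\<dots> = (\<Sum>a\<in>{1..q}. Ps (a # map c [Suc m..<n]))"
    proof (intro sum.cong refl)
      fix a assume "a \<in> {1..q}"
      then have "cyl {m..<n} (c(m := a)) = Ps (map (c(m := a)) [m..<n])"
        using Suc.prems by (intro Suc.IH) auto
      then show "cyl {m..<n} (c(m := a)) = Ps (a # map c [Suc m..<n])"
        using True by (simp add: upt_conv_Cons map_fun_upd)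
    qed
    also have "\<dots> = Ps (map c [Suc m..<n])"
      using Suc.prems by (intro Ps_sum_first) auto
    finally show ?thesis .
  next
    case False
    then show ?thesis by (simp add: cyl_def)
  qed
qed

text \<open>From the center on, removing a vertex disconnects the star into what lies before and after it.
  For all vertices up to some \<open>n\<close> other than \<open>k\<close>, independence is \<open>star_word_factors\<close>.\<close>

lemma box_separated_at:
  assumes "2 \<le> k" and J: "finite J" "J \<subseteq> {..<k}" and K: "finite K" "K \<subseteq> {k<..}"
  shows "box (J \<union> K) E = box J E * box K E"
proof -
  obtain n where n: "k < n" "K \<subseteq> {k<..<n}"
  proof (rule that)
    show "K \<subseteq> {k<..<Suc (Max (insert k K))}" using K by (auto simp: less_Suc_eq_le)
    show "k < Suc (Max (insert k K))" using K(1) by (auto simp: less_Suc_eq_le)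
  qed
  define F where "F v = (if v \<in> J \<union> K then E v else UNIV)" for v
  have single: "cyl ({..<k} \<union> {k<..<n}) c = cyl {..<k} c * cyl {k<..<n} c"
    if c: "\<And>v. v \<in> {..<k} \<union> {k<..<n} \<Longrightarrow> c v \<in> {1..q}" for c
  proof -
    \<comment> \<open>The event does not look at \<open>k\<close>, where \<open>c\<close> need not be a color.\<close>
    define d where "d = c(k := 1)"
    have d: "d i \<in> {1..q}" if "i < n" for i using c[of i] that q5 by (cases i k rule: linorder_cases) (auto simp: d_def)
    have cd: "cyl L c = cyl L d" if "k \<notin> L" for L using that by (intro cyl_cong) (auto simp: d_def)
    have split: "[2..<n] = [2..<k] @ k # [Suc k..<n]"
      using upt_add_eq_append[of 2 k "n - k"] n(1) assms(1) by (simp add: upt_conv_Cons)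
    have "insert k ({..<k} \<union> {k<..<n}) = {..<n}" using n(1) by auto
    then have "cyl ({..<k} \<union> {k<..<n}) d = (\<Sum>a\<in>{1..q}. cyl {..<n} (d(k := a)))"
      by (subst cyl_marginal[of _ k]) auto
    also have "\<dots> = (\<Sum>a\<in>{1..q}. star_word (d 0) (d 1) (map d [2..<k] @ a # map d [Suc k..<n]))"
      using d n(1) assms(1) by (intro sum.cong refl) (subst cyl_star, auto simp: split map_fun_upd)
    also have "\<dots> = star_word (d 0) (d 1) (map d [2..<k]) * Ps (map d [Suc k..<n])"
      using d n(1) assms(1) by (intro star_word_factors) auto
    also have "\<dots> = cyl {..<k} d * cyl {Suc k..<n} d"
      using d n(1) assms(1) cyl_star[of k d] cyl_interval[of n "Suc k" d] by simp
    also have "{Suc k..<n} = {k<..<n}" by auto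
    finally show ?thesis using cd by simp
  qed
  have "box ({..<k} \<union> {k<..<n}) F = box {..<k} F * box {k<..<n} F"
    by (rule box_factors_if_cyl_factors[OF _ _ _ single]) auto
  moreover have "box L E = box L' F" if "L \<subseteq> L'" "L = L' \<inter> (J \<union> K)" for L L'
  proof -
    have "box L E = box L' (\<lambda>v. if v \<in> L then E v else UNIV)" by (rule box_superset[OF that(1)])
    also have "\<dots> = box L' F" using that by (intro box_cong) (auto simp: F_def)
    finally show ?thesis .
  qed
  moreover have "J \<union> K = ({..<k} \<union> {k<..<n}) \<inter> (J \<union> K)" "J = {..<k} \<inter> (J \<union> K)" "K = {k<..<n} \<inter> (J \<union> K)"
    using J(2) n(2) by auto
  ultimately show ?thesis by (metis inf_le1)
qed

lemma box_leaves: "box {0, 1} E = box {0} E * box {1} E"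
proof -
  have single: "cyl ({0} \<union> {1}) c = cyl {0} c * cyl {1} c" if c: "\<And>v. v \<in> {0} \<union> {1} \<Longrightarrow> c v \<in> {1..q}" for c
  proof -
    define d where "d = c(2 := 1)"
    have d: "d i \<in> {1..q}" if "i < 2" for i using c that by (auto simp: d_def less_2_cases_iff)
    have "{0} \<union> {1} = {..<2::nat}" by auto
    then have "cyl ({0} \<union> {1}) d = 1 / real q ^ 2" using cyl_star[of 2 d] d by simp
    moreover have "cyl {0} d = 1 / real q" using cyl_left_line[of 2 d] d by (simp add: Ps_1)
    moreover have "{1} = {1..<2::nat}" by auto
    then have "cyl {1} d = 1 / real q" using cyl_interval[of 2 1 d] d by (simp add: Ps_1 numeral_2_eq_2)
    moreover have "cyl L c = cyl L d" if "2 \<notin> L" for L using that by (intro cyl_cong) (auto simp: d_def)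
    ultimately show ?thesis by (simp add: power2_eq_square)
  qed
  have "box ({0} \<union> {1}) E = box {0} E * box {1} E"
    by (rule box_factors_if_cyl_factors[OF _ _ _ single]) auto
  then show ?thesis by (simp add: insert_commute)
qed

text \<open>Say that \<open>J\<close> ends before \<open>K\<close> does.  The vertex after the last one of \<open>J\<close> then belongs to neither
  set, and cutting there splits off a nonempty part of \<open>K\<close>, so induction applies to the rest.  The cut
  must be at the center or beyond it; the only pair of sets for which this leaves nothing to split off
  are the two leaves.\<close>

lemma box_one_dependent:
  assumes "finite J" "finite K" "\<And>i j. i \<in> J \<Longrightarrow> j \<in> K \<Longrightarrow> i \<noteq> j \<and> \<not> near i j"
  shows "box (J \<union> K) E = box J E * box K E"
  using assms
proof (induction "card J + card K" arbitrary: J K rule: less_induct)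
  case less
  have step: "box (J \<union> K) E = box J E * box K E"
    if fin: "finite J" "finite K" and sep: "\<And>i j. i \<in> J \<Longrightarrow> j \<in> K \<Longrightarrow> i \<noteq> j \<and> \<not> near i j"
      and IH: "\<And>K'. K' \<subset> K \<Longrightarrow> box (J \<union> K') E = box J E * box K' E"
      and ne: "J \<noteq> {}" "K \<noteq> {}" and less: "Max J < Max K" for J K
  proof -
    define m where "m = Max J"
    define k where "k = Max K"
    have m: "m \<in> J" "\<And>i. i \<in> J \<Longrightarrow> i \<le> m" and k: "k \<in> K" "\<And>i. i \<in> K \<Longrightarrow> i \<le> k"
      using fin ne by (auto simp: m_def k_def)
    have mk: "m < k" using less by (simp add: m_def k_def)
    \<comment> \<open>After the left leaf the position \<open>1\<close> is skipped, since it is not adjacent to the left leaf.\<close>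
    define s where "s = max 2 (m + 1)"
    have sK: "s \<notin> K"
      using sep[OF m(1), of s] by (auto simp: s_def near_def level_def max_def)
    show ?thesis
    proof (cases "k < s")
      case True
      then have "k = 1" "m = 0" using mk by (auto simp: s_def)
      then have "J = {0}" "K = {1}"
        using m k sep[OF m(1)] by (force simp: le_Suc_eq)+
      then show ?thesis using box_leaves by (simp add: insert_commute)
    next
      case False
      then have ks: "s < k" using sK k(1) by (cases "k = s") auto
      define K1 where "K1 = K \<inter> {..<s}"
      define K2 where "K2 = K \<inter> {s<..}"
      have "x < s \<or> s < x" if "x \<in> K" for x using that sK by (metis linorder_neqE_nat)
      then have K: "K = K1 \<union> K2" by (auto simp: K1_def K2_def)
      have Js: "J \<subseteq> {..<s}" using m(2) by (fastforce simp: s_def)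
      have sep_at: "box (L \<union> K2) E = box L E * box K2 E" if "finite L" "L \<subseteq> {..<s}" for L
        using that fin by (intro box_separated_at[of s]) (auto simp: s_def K2_def)
      have "box (J \<union> K) E = box ((J \<union> K1) \<union> K2) E"
        by (subst K) (simp only: Un_assoc)
      also have "\<dots> = box (J \<union> K1) E * box K2 E"
        using fin Js by (intro sep_at) (auto simp: K1_def)
      also have "box (J \<union> K1) E = box J E * box K1 E"
      proof (rule IH)
        have "k \<notin> K1" "K1 \<subseteq> K" using ks by (auto simp: K1_def)
        then show "K1 \<subset> K" using k(1) by blast
      qed
      also have "box J E * box K1 E * box K2 E = box J E * box (K1 \<union> K2) E"
        using fin sep_at[of K1] by (simp add: K1_def)
      also have "K1 \<union> K2 = K" using K ..
      finally show ?thesis .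
    qed
  qed
  show ?case
  proof (cases "J = {} \<or> K = {}")
    case True
    then show ?thesis by auto
  next
    case False
    then have ne: "J \<noteq> {}" "K \<noteq> {}" by auto
    then have "Max J \<in> J" "Max K \<in> K" using less.prems by auto
    then have "Max J \<noteq> Max K" using less.prems(3) by metis
    then consider "Max J < Max K" | "Max K < Max J" by linarith
    then show ?thesis
    proof cases
      case 1
      show ?thesis
      proof (rule step[OF less.prems(1,2,3) _ ne 1])
        fix K' assume K': "K' \<subset> K"
        then have "card K' < card K" "finite K'"
          using less.prems(2) by (auto intro: psubset_card_mono finite_subset)
        then show "box (J \<union> K') E = box J E * box K' E"
          using K' less.prems by (intro less.hyps) auto
      qed
    next
      case 2
      have "box (K \<union> J) E = box K E * box J E"
      proof (rule step[OF less.prems(2,1) _ _ ne(2,1) 2])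
        fix J' assume J': "J' \<subset> J"
        then have "card J' < card J" "finite J'"
          using less.prems(1) by (auto intro: psubset_card_mono finite_subset)
        then have "box (J' \<union> K) E = box J' E * box K E"
          using J' less.prems by (intro less.hyps) auto
        then show "box (K \<union> J') E = box K E * box J' E" by (simp add: Un_commute mult.commute)
      qed (use less.prems(3) near_commute in blast)
      then show ?thesis by (simp add: Un_commute mult.commute)
    qed
  qed
qed

lemma box_permute_colors:
  assumes \<sigma>: "\<sigma> permutes {1..q}" and "finite J"
  shows "prob {\<omega> \<in> space M. \<forall>j\<in>J. \<sigma> (Z j \<omega>) \<in> E j} = box J E"
proof -
  obtain n where n: "J \<subseteq> {..<n}" using \<open>finite J\<close> finite_nat_iff_bounded by blast
  define F where "F v = (if v \<in> J then E v else UNIV)" for v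
  have inv_in: "inv \<sigma> a \<in> {1..q} \<longleftrightarrow> a \<in> {1..q}" for a
    using permutes_in_image[OF permutes_inv[OF \<sigma>]] .
  have "box {..<n} (\<lambda>v. \<sigma> -` F v) = box {..<n} F"
  proof (rule box_functionals_agree[of "{..<n}" "\<lambda>F. box {..<n} (\<lambda>v. \<sigma> -` F v)" "{1..q}" "box {..<n}" F])
    fix F v assume v: "v \<in> {..<n}"
    have "box {..<n} (\<lambda>v. \<sigma> -` F v) =
        (\<Sum>a\<in>\<sigma> -` F v \<inter> {1..q}. box {..<n} ((\<lambda>v. \<sigma> -` F v)(v := {a})))"
      using v by (intro box_split) auto
    also have "\<dots> = (\<Sum>a\<in>F v \<inter> {1..q}. box {..<n} (\<lambda>u. \<sigma> -` (F(v := {a})) u))"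
    proof (rule sum.reindex_bij_witness[of _ "inv \<sigma>" \<sigma>])
      fix a assume a: "a \<in> \<sigma> -` F v \<inter> {1..q}"
      show "inv \<sigma> (\<sigma> a) = a" by (rule permutes_inverses(2)[OF \<sigma>])
      show "\<sigma> a \<in> F v \<inter> {1..q}" using a permutes_in_image[OF \<sigma>] by auto
      show "box {..<n} (\<lambda>u. \<sigma> -` (F(v := {\<sigma> a})) u) = box {..<n} ((\<lambda>v. \<sigma> -` F v)(v := {a}))"
        using permutes_inj[OF \<sigma>] by (intro box_cong) (auto simp: inj_eq)
    next
      fix a assume a: "a \<in> F v \<inter> {1..q}"
      show "\<sigma> (inv \<sigma> a) = a" by (rule permutes_inverses(1)[OF \<sigma>])
      then show "inv \<sigma> a \<in> \<sigma> -` F v \<inter> {1..q}" using a inv_in by auto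
    qed
    finally show "box {..<n} (\<lambda>v. \<sigma> -` F v) = (\<Sum>a\<in>F v \<inter> {1..q}. box {..<n} (\<lambda>u. \<sigma> -` (F(v := {a})) u))" .
  next
    fix F :: "nat \<Rightarrow> nat set" assume F: "\<And>v. v \<in> {..<n} \<Longrightarrow> \<exists>a\<in>{1..q}. F v = {a}"
    then obtain c where c: "\<And>v. v \<in> {..<n} \<Longrightarrow> c v \<in> {1..q} \<and> F v = {c v}" by metis
    have "box {..<n} (\<lambda>v. \<sigma> -` F v) = cyl {..<n} (inv \<sigma> \<circ> c)"
      unfolding cyl_def using c permutes_inv_eq[OF \<sigma>] by (intro box_cong) force
    also have "\<dots> = star_law (map (inv \<sigma>) (map c [0..<n]))"
      using c inv_in by (subst cyl_prefix) auto
    also have "\<dots> = star_law (map c [0..<n])"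
      using c by (intro star_law_map permutes_inv[OF \<sigma>]) auto
    also have "\<dots> = box {..<n} F"
      unfolding cyl_def[symmetric] using c
      by (subst cyl_prefix[symmetric]) (auto simp: cyl_def intro!: box_cong)
    finally show "box {..<n} (\<lambda>v. \<sigma> -` F v) = box {..<n} F" .
  next
    fix F v assume "v \<in> {..<n}"
    then show "box {..<n} F = (\<Sum>a\<in>F v \<inter> {1..q}. box {..<n} (F(v := {a})))"
      by (intro box_split) auto
  qed simp
  moreover have "box J E = box {..<n} F" unfolding F_def by (rule box_superset[OF n])
  moreover have "prob {\<omega> \<in> space M. \<forall>j\<in>J. \<sigma> (Z j \<omega>) \<in> E j} = box {..<n} (\<lambda>v. \<sigma> -` F v)"
    unfolding box_def using n by (intro arg_cong[where f = prob]) (auto simp: F_def)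
  ultimately show ?thesis by simp
qed

end

section \<open>Paths of the star\<close>

lemma distinct_same_level: "level i = level j \<Longrightarrow> i \<noteq> j \<Longrightarrow> level i = 0"
  by (auto simp: level_def)

lemma upward_path:
  assumes "successively (\<lambda>i j. level j = level i + 1) ks" "ks \<noteq> []"
  shows "\<exists>i n. n \<ge> level i + 2 \<and> ks = i # [level i + 2..<n]"
  using assms
proof (induction ks rule: induct_list012)
  case (2 i)
  then show ?case by (intro exI[of _ i] exI[of _ "level i + 2"]) auto
next
  case (3 i j ks)
  then obtain n where n: "n \<ge> level j + 2" "j # ks = j # [level j + 2..<n]" by auto
  have j: "j = level i + 2" "level j + 2 = Suc j" using 3(3) by (auto simp: level_def)
  have "i # j # ks = i # [level i + 2..<n]"
    using n j by (simp add: upt_conv_Cons)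
  then show ?case using n j by (intro exI[of _ i] exI[of _ n]) auto
qed simp

text \<open>At a turning point the two neighbours on the path are different vertices of the same level, hence
  the two leaves.  A leaf has no further neighbour, so the path ends on both sides.\<close>

lemma path_cases:
  assumes "distinct ks" "successively near ks"
  shows "successively (\<lambda>i j. level j = level i + 1) ks \<or> successively (\<lambda>i j. level i = level j + 1) ks \<or>
    ks = [0, 2, 1] \<or> ks = [1, 2, 0]"
  using assms
proof (induction ks rule: induct_list012)
  case (3 i j ks)
  have ij: "i \<noteq> j" "near i j" "i \<notin> set ks" using 3 by auto
  have IH: "successively (\<lambda>i j. level j = level i + 1) (j # ks) \<or>
      successively (\<lambda>i j. level i = level j + 1) (j # ks) \<or> j # ks = [0, 2, 1] \<or> j # ks = [1, 2, 0]"
    using 3 by auto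
  show ?case
  proof (cases ks)
    case Nil
    then show ?thesis using ij by (auto simp: near_def)
  next
    case (Cons k ks')
    have ik: "i \<noteq> k" using ij Cons by auto
    from IH consider
      "successively (\<lambda>i j. level j = level i + 1) (j # ks)" |
      "successively (\<lambda>i j. level i = level j + 1) (j # ks)" | "j \<in> {0, 1}" "2 \<in> set ks" by auto
    then show ?thesis
    proof cases
      case 1
      then have "level k = level j + 1" using Cons by simp
      then have "level j = level i + 1" using ij(2) distinct_same_level[OF _ ik] by (auto simp: near_def)
      then show ?thesis using 1 by simp
    next
      case 2
      then have jk: "level j = level k + 1" using Cons by simp
      show ?thesis
      proof (cases "level i = level j + 1")
        case True
        then show ?thesis using 2 by simp
      next
        case False
        then have ij': "level j = level i + 1" using ij(2) by (simp add: near_def)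
        then have "level i = level k" using jk by simp
        then have "level i = 0" "level k = 0" using distinct_same_level[OF _ ik] by auto
        moreover have "ks' = []" using 2 Cons \<open>level k = 0\<close> by (cases ks') auto
        ultimately have "{i, k} = {0, 1}" "j = 2" "ks' = []"
          using ik ij' by (auto simp: level_def)
        then show ?thesis using Cons by (auto simp: doubleton_eq_iff)
      qed
    next
      case 3
      then have "level i = 1" using ij(2) by (auto simp: near_def level_def)
      then have "i = 2" by (simp add: level_def)
      then show ?thesis using 3 ij(3) by simp
    qed
  qed
qed auto

context star_process
begin

lemma cyl_upward_path:
  assumes up: "successively (\<lambda>i j. level j = level i + 1) ks" and c: "\<And>k. k \<in> set ks \<Longrightarrow> c k \<in> {1..q}"
  shows "cyl (set ks) c = Ps (map c ks)"
proof (cases "ks = []")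
  case True
  then show ?thesis by (simp add: cyl_def)
next
  case False
  then obtain i n where n: "n \<ge> level i + 2" and ks: "ks = i # [level i + 2..<n]"
    using upward_path[OF up] by blast
  define d where "d k = (if k \<in> set ks then c k else 1)" for k
  have d: "d k \<in> {1..q}" for k using c q5 by (auto simp: d_def)
  have "cyl (set ks) d = Ps (map d ks)"
  proof (cases "i = 0")
    case True
    then have "ks = 0 # [2..<n]" "n \<ge> 2" using ks n by (simp_all add: level_def numeral_2_eq_2)
    then show ?thesis using cyl_left_line[of n d] d by simp
  next
    case False
    then have "ks = [i..<n]" "n \<ge> 2" using ks n by (simp_all add: level_def upt_conv_Cons)
    then show ?thesis using cyl_interval[of n i d] d False by simp
  qed
  moreover have "cyl (set ks) d = cyl (set ks) c" by (rule cyl_cong) (simp add: d_def)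
  moreover have "map d ks = map c ks" by (simp add: d_def)
  ultimately show ?thesis by simp
qed

lemma cyl_path:
  assumes "distinct ks" "successively near ks" and c: "\<And>k. k \<in> set ks \<Longrightarrow> c k \<in> {1..q}"
  shows "cyl (set ks) c = Ps (map c ks)"
proof -
  have center: "cyl {0, 1, 2} c = Ps [c 0, c 2, c 1]" if "\<And>k. k \<in> {0, 1, 2} \<Longrightarrow> c k \<in> {1..q}"
  proof -
    have "{0, 1, 2} = {..<3::nat}" by auto
    moreover have "[2..<3] = [2::nat]" by (simp add: upt_conv_Cons)
    ultimately show ?thesis using cyl_star[of 3 c] that by (simp add: star_word_single numeral_3_eq_3 less_Suc_eq numeral_2_eq_2)
  qed
  from path_cases[OF assms(1,2)] show ?thesis
  proof (elim disjE)
    assume "successively (\<lambda>i j. level j = level i + 1) ks"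
    then show ?thesis using c by (rule cyl_upward_path)
  next
    assume "successively (\<lambda>i j. level i = level j + 1) ks"
    then have "cyl (set (rev ks)) c = Ps (map c (rev ks))"
      using c by (intro cyl_upward_path) (simp_all add: successively_rev)
    then show ?thesis by (simp add: Ps_rev flip: rev_map)
  next
    assume "ks = [0, 2, 1]"
    then show ?thesis using center c by (simp add: insert_commute)
  next
    assume "ks = [1, 2, 0]"
    then show ?thesis using center c Ps_rev[of "[c 0, c 2, c 1]"] by (simp add: insert_commute)
  qed
qed

end

section \<open>The coloring of the star graph\<close>

fun position :: "vertex \<Rightarrow> nat" where
  "position Center = 2"
| "position (Arm i j) = (if i = 1 then 0 else if i = 2 then 1 else j + 2)"

fun vertex_at :: "nat \<Rightarrow> vertex" where
  "vertex_at 0 = Arm 1 1"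
| "vertex_at (Suc 0) = Arm 2 1"
| "vertex_at (Suc (Suc 0)) = Center"
| "vertex_at (Suc (Suc (Suc j))) = Arm 3 (Suc j)"

lemma position_vertex_at: "position (vertex_at n) = n"
  by (cases n rule: vertex_at.cases) auto

lemma star_verts_infinity: "star_verts \<infinity> = {Center, Arm 1 1, Arm 2 1} \<union> {Arm 3 j | j. 1 \<le> j}"
  by (simp add: star_verts_def)

lemma star_vert_cases:
  assumes "v \<in> star_verts \<infinity>"
  obtains "v = Center" | "v = Arm 1 1" | "v = Arm 2 1" | j where "v = Arm 3 (Suc j)"
proof -
  have "\<exists>i. j = Suc i" if "1 \<le> j" for j using that by (cases j) auto
  then show thesis using assms that by (auto simp: star_verts_infinity)
qed

lemma vertex_at_position: "v \<in> star_verts \<infinity> \<Longrightarrow> vertex_at (position v) = v"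
  by (elim star_vert_cases) (simp_all add: numeral_2_eq_2)

lemma star_edges_iff_near:
  assumes "u \<in> star_verts \<infinity>" "v \<in> star_verts \<infinity>"
  shows "(u, v) \<in> star_edges \<infinity> \<longleftrightarrow> near (position u) (position v)"
proof -
  have "(u, v) \<in> star_edges \<infinity> \<longleftrightarrow> (u, v) \<in> oriented_edges \<or> (v, u) \<in> oriented_edges"
    using assms by (auto simp: star_edges_def)
  also have "\<dots> \<longleftrightarrow> near (position u) (position v)"
    using assms by (elim star_vert_cases) (auto simp: oriented_edges_def near_def level_def)
  finally show ?thesis .
qed

lemma separated_if_dist_gt_1:
  assumes "set_graph_dist E A B > 1" "u \<in> A" "v \<in> B"
  shows "u \<noteq> v \<and> (u, v) \<notin> E"
proof -
  have le: "set_graph_dist E A B \<le> enat n" if "(u, v) \<in> E ^^ n" for n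
  proof -
    have "set_graph_dist E A B \<le> graph_dist E u v"
      unfolding set_graph_dist_def using assms(2,3) by (meson INF_lower2 order_refl)
    also have "\<dots> \<le> enat n" unfolding graph_dist_def using that by (intro INF_lower) simp
    finally show ?thesis .
  qed
  have "u \<noteq> v"
  proof
    assume "u = v"
    then have "set_graph_dist E A B \<le> enat 0" by (intro le) simp
    then show False using assms(1) by (simp add: zero_enat_def[symmetric])
  qed
  moreover have "(u, v) \<notin> E"
  proof
    assume "(u, v) \<in> E"
    then have "set_graph_dist E A B \<le> enat 1" by (intro le) simp
    then have "set_graph_dist E A B \<le> 1" by (simp only: one_enat_def)
    then show False using assms(1) by (meson leD)
  qed
  ultimately show ?thesis ..
qed

context star_process
begin

abbreviation X :: "vertex \<Rightarrow> 'a \<Rightarrow> nat" where "X v \<equiv> Z (position v)"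

sublocale vertices: finite_valued_process M "{1..q}" X
  by unfold_locales (rule finite_S, rule Z_measurable)

lemma vertices_box:
  assumes "J \<subseteq> star_verts \<infinity>"
  shows "vertices.box J E = box (position ` J) (\<lambda>i. E (vertex_at i))"
proof -
  have "(\<forall>j\<in>J. X j \<omega> \<in> E j) \<longleftrightarrow> (\<forall>i\<in>position ` J. Z i \<omega> \<in> E (vertex_at i))" for \<omega>
    using assms vertex_at_position by (simp add: subset_eq)
  then show ?thesis by (simp only: vertices.box_def box_def)
qed

lemma prob_path:
  assumes "graph_path (star_verts \<infinity>) (star_edges \<infinity>) us" "length ys = length us" "set ys \<subseteq> {1..q}"
  shows "prob {\<omega> \<in> space M. \<forall>i<length us. X (us ! i) \<omega> = ys ! i} = Ps ys"
proof -
  define ks where "ks = map position us"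
  have us: "set us \<subseteq> star_verts \<infinity>" "distinct us" "successively (\<lambda>u v. (u, v) \<in> star_edges \<infinity>) us"
    using assms(1) by (auto simp: graph_path_def)
  have "inj_on position (set us)"
    using us(1) by (intro inj_on_inverseI[of _ vertex_at] vertex_at_position) auto
  then have ks: "distinct ks" using us(2) by (simp add: ks_def distinct_map)
  have near: "successively near ks"
    unfolding ks_def successively_map
    by (rule successively_mono[OF us(3)]) (use us(1) star_edges_iff_near in blast)
  define c where "c k = the (map_of (zip ks ys) k)" for k
  have "length ys = length ks" using assms(2) by (simp add: ks_def)
  then have ys: "ys = map c ks"
    using ks by (intro nth_equalityI) (auto simp: c_def map_of_zip_nth)
  have "prob {\<omega> \<in> space M. \<forall>i<length us. X (us ! i) \<omega> = ys ! i} = cyl (set ks) c"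
    unfolding cyl_def box_def ys by (intro arg_cong[where f = prob]) (auto simp: ks_def all_set_conv_all_nth)
  also have "\<dots> = Ps ys"
    unfolding ys using ks near assms(3) ys by (intro cyl_path) auto
  finally show ?thesis .
qed

lemma prob_star:
  assumes "xL \<in> {1..q}" "x0 \<in> {1..q}" "xR \<in> {1..q}" "set xs \<subseteq> {1..q}"
  shows "prob {\<omega> \<in> space M. X (Arm 1 1) \<omega> = xL \<and> X Center \<omega> = x0 \<and> X (Arm 2 1) \<omega> = xR \<and>
    (\<forall>j\<in>{1..length xs}. X (Arm 3 j) \<omega> = xs ! (j - 1))} = P_star_graph q xL x0 xR xs"
proof -
  let ?w = "xL # xR # x0 # xs"
  have arm: "(\<forall>j\<in>{1..length xs}. X (Arm 3 j) \<omega> = xs ! (j - 1)) \<longleftrightarrow>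
      (\<forall>i<length xs. Z (Suc (Suc (Suc i))) \<omega> = xs ! i)" for \<omega>
  proof -
    have "{1..length xs} = Suc ` {..<length xs}" by (simp add: image_Suc_lessThan)
    then show ?thesis by auto
  qed
  have "prob {\<omega> \<in> space M. \<forall>i<length ?w. Z i \<omega> = ?w ! i} = star_law ?w"
    using assms by (intro law) auto
  moreover have "(\<forall>i<length ?w. Z i \<omega> = ?w ! i) \<longleftrightarrow> X (Arm 1 1) \<omega> = xL \<and> X Center \<omega> = x0 \<and>
      X (Arm 2 1) \<omega> = xR \<and> (\<forall>j\<in>{1..length xs}. X (Arm 3 j) \<omega> = xs ! (j - 1))" for \<omega>
    unfolding arm by (auto simp: All_less_Suc2 numeral_2_eq_2)
  ultimately show ?thesis by (simp add: star_word_def)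
qed

lemma random_coloring_star: "random_coloring q (star_verts \<infinity>) (star_edges \<infinity>) M X"
  unfolding random_coloring_def
proof (intro conjI ballI, goal_cases)
  case (1 v)
  show ?case by (rule Z_measurable)
next
  case (2 e)
  then obtain u v where e: "e = (u, v)" and uv: "(u, v) \<in> star_edges \<infinity>" by (cases e) auto
  have path: "graph_path (star_verts \<infinity>) (star_edges \<infinity>) [u, v]"
    using uv star_edges_iff_near[of u v]
    by (auto simp: graph_path_def star_edges_def near_def)
  have "AE \<omega> in M. \<not> (\<forall>i<length [u, v]. X ([u, v] ! i) \<omega> = [a, a] ! i)" if "a \<in> {1..q}" for a
  proof -
    have "prob {\<omega> \<in> space M. \<forall>i<length [u, v]. X ([u, v] ! i) \<omega> = [a, a] ! i} = 0"
      using prob_path[OF path, of "[a, a]"] that by (simp add: Ps_improper)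
    moreover have "{\<omega> \<in> space M. \<forall>i<length [u, v]. X ([u, v] ! i) \<omega> = [a, a] ! i} \<in> events"
      using vertices.box_events[of "{u, v}" "\<lambda>_. {a}"] by (simp add: All_less_Suc2)
    ultimately have "AE \<omega> in M. \<omega> \<notin> {\<omega> \<in> space M. \<forall>i<length [u, v]. X ([u, v] ! i) \<omega> = [a, a] ! i}"
      by (simp only: prob_eq_0)
    with AE_space show ?thesis by eventually_elim blast
  qed
  then have "AE \<omega> in M. \<forall>a\<in>{1..q}. \<not> (X u \<omega> = a \<and> X v \<omega> = a)"
    by (intro AE_finite_allI) (auto simp: All_less_Suc2)
  with AE_space have "AE \<omega> in M. X u \<omega> \<noteq> X v \<omega>"
  proof eventually_elim
    case (elim \<omega>)
    then show ?case using Z_in_S[of \<omega> "position u"] by auto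
  qed
  then show ?case by (simp add: e)
qed

lemma one_dependent_star: "one_dependent q (star_verts \<infinity>) (star_edges \<infinity>) M X"
  unfolding one_dependent_def
proof (intro allI impI)
  fix A B assume AB: "A \<subseteq> star_verts \<infinity>" "B \<subseteq> star_verts \<infinity>" "set_graph_dist (star_edges \<infinity>) A B > 1"
  note sep = separated_if_dist_gt_1[OF AB(3)]
  show "indep_var (color_space q A) (\<lambda>\<omega>. \<lambda>v\<in>A. X v \<omega>) (color_space q B) (\<lambda>\<omega>. \<lambda>v\<in>B. X v \<omega>)"
  proof (rule vertices.indep_var_if_box_factors)
    fix J K :: "vertex set" and E
    assume JK: "finite J" "finite K" "J \<subseteq> A" "K \<subseteq> B"
    have "box (position ` J \<union> position ` K) (\<lambda>i. E (vertex_at i)) =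
        box (position ` J) (\<lambda>i. E (vertex_at i)) * box (position ` K) (\<lambda>i. E (vertex_at i))"
    proof (rule box_one_dependent)
      fix i j assume "i \<in> position ` J" "j \<in> position ` K"
      then obtain u v where uv: "u \<in> A" "v \<in> B" "i = position u" "j = position v" using JK by auto
      then have V: "u \<in> star_verts \<infinity>" "v \<in> star_verts \<infinity>" using AB by auto
      show "i \<noteq> j \<and> \<not> near i j"
        using sep[OF uv(1,2)] star_edges_iff_near[OF V] V uv(3,4) vertex_at_position by metis
    qed (use JK in auto)
    then show "vertices.box (J \<union> K) E = vertices.box J E * vertices.box K E"
      using JK AB by (subst (1 2 3) vertices_box) (auto simp: image_Un)
  next
    show "A \<inter> B = {}" using sep by blast
  qed
qed

lemma color_invariant_star: "color_invariant q (star_verts \<infinity>) M X"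
  unfolding color_invariant_def
proof (intro allI impI)
  fix \<sigma> assume \<sigma>: "\<sigma> permutes {1..q}"
  let ?V = "star_verts \<infinity>"
  have \<sigma>X: "(\<lambda>\<omega>. \<sigma> (X v \<omega>)) \<in> M \<rightarrow>\<^sub>M count_space {1..q}" for v
    using permutes_in_image[OF \<sigma>] by (intro measurable_compose[OF Z_measurable]) auto
  have meas: "(\<lambda>\<omega>. \<lambda>v\<in>?V. \<sigma> (X v \<omega>)) \<in> M \<rightarrow>\<^sub>M color_space q ?V"
    "(\<lambda>\<omega>. \<lambda>v\<in>?V. X v \<omega>) \<in> M \<rightarrow>\<^sub>M color_space q ?V"
    by (rule measurable_restrict; rule \<sigma>X Z_measurable)+
  have \<sigma>_in: "\<sigma> (X v \<omega>) \<in> {1..q}" "X v \<omega> \<in> {1..q}" if "\<omega> \<in> space M" for v \<omega>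
    using Z_in_S[OF that, of "position v"] permutes_in_image[OF \<sigma>] by auto
  show "distr M (color_space q ?V) (\<lambda>\<omega>. \<lambda>v\<in>?V. \<sigma> (X v \<omega>)) = distr M (color_space q ?V) (\<lambda>\<omega>. \<lambda>v\<in>?V. X v \<omega>)"
  proof (rule measure_eqI_PiM_infinite)
    fix E J assume J: "finite J" "J \<subseteq> ?V" "\<And>i. i \<in> J \<Longrightarrow> E i \<in> sets (count_space {1..q})"
    have emb: "prod_emb ?V (\<lambda>_. count_space {1..q}) J (Pi\<^sub>E J E) \<in> sets (color_space q ?V)"
      using J by (intro sets_PiM_I) auto
    have pre: "(\<lambda>\<omega>. \<lambda>v\<in>?V. f v \<omega>) -` prod_emb ?V (\<lambda>_. count_space {1..q}) J (Pi\<^sub>E J E) \<inter> space M =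
        {\<omega> \<in> space M. \<forall>j\<in>J. f j \<omega> \<in> E j}"
      if "\<And>v \<omega>. \<omega> \<in> space M \<Longrightarrow> f v \<omega> \<in> {1..q}" for f
      using that J(2) by (auto simp: prod_emb_def PiE_iff extensional_def restrict_def subset_eq)
    have "prob {\<omega> \<in> space M. \<forall>i\<in>position ` J. \<sigma> (Z i \<omega>) \<in> E (vertex_at i)} = box (position ` J) (\<lambda>i. E (vertex_at i))"
      using J(1) by (intro box_permute_colors[OF \<sigma>]) auto
    moreover have "(\<forall>i\<in>position ` J. \<sigma> (Z i \<omega>) \<in> E (vertex_at i)) \<longleftrightarrow> (\<forall>j\<in>J. \<sigma> (X j \<omega>) \<in> E j)" for \<omega>
      using J(2) vertex_at_position by (simp add: subset_eq)
    ultimately have "prob {\<omega> \<in> space M. \<forall>j\<in>J. \<sigma> (X j \<omega>) \<in> E j} = prob {\<omega> \<in> space M. \<forall>j\<in>J. X j \<omega> \<in> E j}"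
      using vertices_box[OF J(2), of E] by (simp add: vertices.box_def)
    moreover note pre[of "\<lambda>v \<omega>. \<sigma> (X v \<omega>)", OF \<sigma>_in(1)] pre[of X, OF \<sigma>_in(2)]
    ultimately show "emeasure (distr M (color_space q ?V) (\<lambda>\<omega>. \<lambda>v\<in>?V. \<sigma> (X v \<omega>)))
          (prod_emb ?V (\<lambda>_. count_space {1..q}) J (Pi\<^sub>E J E)) =
        emeasure (distr M (color_space q ?V) (\<lambda>\<omega>. \<lambda>v\<in>?V. X v \<omega>))
          (prod_emb ?V (\<lambda>_. count_space {1..q}) J (Pi\<^sub>E J E))"
      using emb meas by (simp only: emeasure_distr emeasure_eq_measure)
  next
    interpret D: prob_space "distr M (color_space q ?V) (\<lambda>\<omega>. \<lambda>v\<in>?V. \<sigma> (X v \<omega>))"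
      by (rule prob_space_distr) (rule meas)
    show "finite_measure (distr M (color_space q ?V) (\<lambda>\<omega>. \<lambda>v\<in>?V. \<sigma> (X v \<omega>)))"
      by (rule D.finite_measure_axioms)
  qed simp_all
qed

end

lemma (in five_colors) star_process_exists:
  obtains M :: "(vertex \<Rightarrow> nat) measure" and Z where "star_process q M Z"
proof -
  have S: "finite {1..q}" "{1..q} \<noteq> {}" using q5 by auto
  obtain M0 :: "(nat list \<Rightarrow> nat) measure" and Z0 where M0: "prob_space M0"
    and Z0: "\<And>n. Z0 n \<in> M0 \<rightarrow>\<^sub>M count_space {1..q}"
    and law0: "\<And>xs. set xs \<subseteq> {1..q} \<Longrightarrow>
      measure M0 {\<omega> \<in> space M0. \<forall>i<length xs. Z0 i \<omega> = xs ! i} = star_law xs"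
    by (rule random_sequence_exists[OF S star_law_simps(1) star_law_nonneg star_law_consistent])
      (assumption | rule that)+
  interpret M0: prob_space M0 by (rule M0)
  let ?V = "\<Pi>\<^sub>M v\<in>(UNIV :: vertex set). count_space {1..q}"
  define f where "f \<omega> v = Z0 (position v) \<omega>" for \<omega> v
  have f: "f \<in> M0 \<rightarrow>\<^sub>M ?V"
  proof -
    have "(\<lambda>\<omega>. f \<omega> v) \<in> M0 \<rightarrow>\<^sub>M count_space {1..q}" for v
      using Z0[of "position v"] by (simp only: f_def[abs_def])
    moreover have "f \<omega> v \<in> {1..q}" if "\<omega> \<in> space M0" for \<omega> v
      using measurable_space[OF Z0 that] by (simp add: f_def)
    then have "(\<lambda>\<omega> v. f \<omega> v) \<in> space M0 \<rightarrow> (\<Pi>\<^sub>E v\<in>UNIV. space (count_space {1..q}))" by auto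
    ultimately have "(\<lambda>\<omega> v. f \<omega> v) \<in> M0 \<rightarrow>\<^sub>M ?V" by (rule measurable_PiM_single')
    then show ?thesis by simp
  qed
  define M where "M = distr M0 ?V f"
  define Z where "Z n \<omega> = \<omega> (vertex_at n)" for n and \<omega> :: "vertex \<Rightarrow> nat"
  have Z: "Z n \<in> M \<rightarrow>\<^sub>M count_space {1..q}" for n
    unfolding M_def Z_def measurable_distr_eq1 by (rule measurable_component_singleton) simp
  interpret M: prob_space M unfolding M_def by (rule M0.prob_space_distr[OF f])
  interpret process: finite_valued_process M "{1..q}" Z
    by unfold_locales (use Z in auto)
  have "star_process q M Z"
  proof unfold_locales
    fix xs :: "nat list" assume xs: "set xs \<subseteq> {1..q}"
    let ?B = "{\<omega> \<in> space M. \<forall>i<length xs. Z i \<omega> = xs ! i}"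
    have "?B = {\<omega> \<in> space M. \<forall>j\<in>{..<length xs}. Z j \<omega> \<in> {xs ! j}}" by auto
    then have "?B \<in> M.events" by (simp only: process.box_events finite_lessThan)
    then have "measure M ?B = measure M0 (f -` ?B \<inter> space M0)"
      unfolding M_def sets_distr by (rule measure_distr[OF f])
    also have "f -` ?B \<inter> space M0 = {\<omega> \<in> space M0. \<forall>i<length xs. Z0 i \<omega> = xs ! i}"
      using measurable_space[OF f] by (auto simp: M_def Z_def f_def position_vertex_at)
    finally show "measure M ?B = star_law xs" using law0[OF xs] by simp
  qed
  then show thesis by (rule that)
qed

theorem theorem1p5:
  fixes q :: nat
  assumes "q \<ge> 5"
  shows "\<exists>(M :: (vertex \<Rightarrow> nat) measure) (X :: vertex \<Rightarrow> (vertex \<Rightarrow> nat) \<Rightarrow> nat).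
    prob_space M \<and>
    random_coloring q (star_verts \<infinity>) (star_edges \<infinity>) M X \<and>
    one_dependent q (star_verts \<infinity>) (star_edges \<infinity>) M X \<and>
    (\<forall>xL x0 xR xs. xL \<in> {1..q} \<longrightarrow> x0 \<in> {1..q} \<longrightarrow> xR \<in> {1..q} \<longrightarrow> set xs \<subseteq> {1..q} \<longrightarrow>
       measure M {\<omega> \<in> space M.
           X (Arm 1 1) \<omega> = xL \<and> X Center \<omega> = x0 \<and> X (Arm 2 1) \<omega> = xR \<and>
           (\<forall>j\<in>{1..length xs}. X (Arm 3 j) \<omega> = xs ! (j - 1))}
         = P_star_graph q xL x0 xR xs) \<and>
    color_invariant q (star_verts \<infinity>) M X \<and>
    (\<forall>us ys. graph_path (star_verts \<infinity>) (star_edges \<infinity>) us \<longrightarrow>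
       length ys = length us \<longrightarrow> set ys \<subseteq> {1..q} \<longrightarrow>
       measure M {\<omega> \<in> space M. \<forall>i<length us. X (us ! i) \<omega> = ys ! i} = Pstar q ys)"
proof -
  interpret five_colors q by unfold_locales (rule assms)
  obtain M :: "(vertex \<Rightarrow> nat) measure" and Z where "star_process q M Z"
    by (rule star_process_exists)
  then interpret star_process q M Z .
  show ?thesis
    by (intro exI[of _ M] exI[of _ X] conjI allI impI prob_space_axioms random_coloring_star
        one_dependent_star prob_star color_invariant_star prob_path)
qed

end
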